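(* Let $\mathcal Z$ be a Banach space with data $(\mathfrak X,\lambda,Q)$ satisfying Assumption (W) of the context, let $(Z_t)$ be the associated piecewise deterministic Markov process with semigroup $\mathcal P_t$, and let $(\mathcal L,D_{C_0})$ be its generator on $C_0(\mathcal Z)$. Suppose $\mathcal Z$ is equipped with a probability measure $\mu_0$, and define a transition kernel $Q^*$ by $$\int_{\mathcal Z}\int_{\mathcal Z} g(y,z)\,Q^*(y,dz)\,\mu_0(dy)=\int_{\mathcal Z}\int_{\mathcal Z} g(y,z)\,Q(z,dy)\,\mu_0(dz)\qquad\text{for all } g\in C_b(\mathcal Z\times\mathcal Z).$$ Let $\Phi:\mathcal Z\to\mathbb R$ be lower semicontinuous and bounded from below, and let $\mu$ be the probability measure with $\mu\propto e^{-\Phi}\mu_0$. Let $L_{\mathfrak X}^*$ denote the adjoint of $(L_{\mathfrak X},D(L_{\mathfrak X}))$ as an operator acting on $L^2_{\mu_0}$, and assume that $$e^{\Phi(z)}L_{\mathfrak X}^*(e^{-\Phi(\cdot)})(z)+\int_{\mathcal Z}\lambda(y)e^{\Phi(z)-\Phi(y)}\,Q^*(z,dy)-\lambda(z)=0 .$$ Then $\mu$ is formally an invariant measure for $\mathcal P_t$ in the sense that $$\int_{\mathcal Z}\mathcal L f(z)\,\mu(dz)=0\qquad\text{for all } f\in D(L_{\mathfrak X})\cap D_{C_0}.$$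
   Context: Let $(\mathcal Z,\|\cdot\|_{\mathcal Z})$ be a (possibly infinite dimensional) Banach space with its Borel $\sigma$-algebra; $B_R$ is the open ball of radius $R$ centred at $0$; $C_b$ denotes bounded continuous real functions with the supremum norm. Data. $\mathfrak X:\mathcal Z\to\mathcal Z$ is a vector field generating a flow map $(\varphi_t)_{t\ge0}$, $\frac{d}{dt}\varphi_t(z)=\mathfrak X(\varphi_t(z))$, $\varphi_0(z)=z$, well defined for all $t\ge 0$ and $z\in\mathcal Z$. $\lambda_{\mathrm r},\lambda_{\mathrm b}:\mathcal Z\to[0,\infty)$ are the refreshment and reflection intensities, $Q_{\mathrm r},Q_{\mathrm b}$ the refreshment and reflection kernels. Put $\lambda=\lambda_{\mathrm r}+\lambda_{\mathrm b}$ and let $Q$ be the transition kernel with $\lambda(z)Q(z,\cdot)=\lambda_{\mathrm r}(z)Q_{\mathrm r}(z,\cdot)+\lambda_{\mathrm b}(z)Q_{\mathrm b}(z,\cdot)$. For each $z$ there is $\varepsilon(z)>0$ such that $s\mapsto\lambda(\varphi_s(z))$ is integrable on $[0,\varepsilon(z))$; $z\mapsto Q(z,A)$ is measurable for every Borel $A$; and $Q(z,\{z\})=0$ for all $z$. Assumption (W): (i) $\lambda_{\mathrm r},\lambda_{\mathrm b}$ are measurable. (ii) For each $z$, $Q_{\mathrm b}(z,\cdot),Q_{\mathrm r}(z,\cdot)$ are Markov transition kernels on $\mathcal Z$, and $z\mapsto Q_{\mathrm b}f(z)$, $z\mapsto Q_{\mathrm r}f(z)$ are measurable for every bounded measurable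 $f$. (iii) $Q_{\mathrm b}(z,\{y:\|y\|_{\mathcal Z}\le\|z\|_{\mathcal Z}\})=1$ for all $z\in\mathcal Z$. (iv) For all $\varepsilon>0$ there exists $R>0$ such that $Q_{\mathrm r}(z,B_R)>1-\varepsilon$ for all $z\in B_R$. (v) For all $R>0$, $\sup_{z\in B_R}\lambda_{\mathrm b}(z)<\infty$. (vi) There is $M>0$ with $\lambda_{\mathrm r}(z)\le M$ for all $z\in\mathcal Z$. (vii) There is a continuous function $t\mapsto c_t\in(0,\infty)$ with $\|\varphi_t(z)\|_{\mathcal Z}\le c_t(1+\|z\|_{\mathcal Z})$ for all $z\in\mathcal Z$, $t\ge0$. (viii) $\lambda_{\mathrm r},\lambda_{\mathrm b}$ are continuous and $Q_{\mathrm b}f,Q_{\mathrm r}f$ are continuous for every bounded continuous $f$. PDMP: started from $z$, the first jump time $T_1$ satisfies $\mathbb P(T_1>t)=\exp(-\int_0^t\lambda(\varphi_s(z))ds)$; $Z_t=\varphi_t(z)$ for $t<T_1$; $Z_{T_1}$ has law $Q(\varphi_{T_1}(z),\cdot)$; then the procedure is repeated independently from $Z_{T_1}$. Under Assumption (W) the process is taken to be defined for all $t\ge0$. $\mathcal P_tf(z)=\mathbb E_z[f(Z_t)]$. $C_0(\mathcal Z)=\{f\in C_b(\mathcal Z):\lim_{t\to0}\|\mathcal P_tf-f\|_\infty=0\}$, on which $\mathcal P_t$ is a strongly continuous contraction semigroup; $(\mathcal L,D_{C_0})$ is its generator on $C_0(\mathcal Z)$. For $f\in D_{C_0}\cap D(L_{\mathfrak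 X})$, $$\mathcal Lf(z)=L_{\mathfrak X}f(z)+\lambda(z)\int_{\mathcal Z}(f(y)-f(z))\,Q(z,dy).$$ Here $L_{\mathfrak X}f(z)=\frac{d}{dt}f(\varphi_t(z))|_{t=0}$ is the derivative along the flow, viewed as an operator in $L^2_{\mu_0}$ with domain $D(L_{\mathfrak X})$ (those $f$ for which $\frac1t(f\circ\varphi_t-f)$ converges in $L^2_{\mu_0}$ as $t\to0$). *)

theory Defs
  imports "HOL-Probability.Probability"
begin

section \<open>Data of a piecewise deterministic Markov process\<close>

text \<open>Only the restriction of the flow \<open>\<phi>\<close> to nonnegative times is constrained. Markov transition
  kernels are measurable maps into \<^const>\<open>prob_algebra\<close>, which bundles the probability measure
  property and the measurability of \<open>z \<mapsto> Q(z, A)\<close>.\<close>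

locale pdmp_data =
  fixes X :: "'z::banach \<Rightarrow> 'z"
    and \<phi> :: "real \<Rightarrow> 'z \<Rightarrow> 'z"
    and lr lb lam :: "'z \<Rightarrow> real"
    and Qr Qb Q :: "'z \<Rightarrow> 'z measure"
  assumes flow_0: "\<And>z. \<phi> 0 z = z"
    and flow_add: "\<And>s t z. 0 \<le> s \<Longrightarrow> 0 \<le> t \<Longrightarrow> \<phi> (s + t) z = \<phi> s (\<phi> t z)"
    and flow_deriv: "\<And>t z. 0 \<le> t \<Longrightarrow>
          ((\<lambda>s. \<phi> s z) has_vector_derivative X (\<phi> t z)) (at t within {0..})"
    and lr_nonneg: "\<And>z. 0 \<le> lr z"
    and lb_nonneg: "\<And>z. 0 \<le> lb z"
    and lam_eq: "\<And>z. lam z = lr z + lb z"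
    and lam_integrable: "\<And>z. \<exists>\<epsilon>>0. set_integrable lborel {0..<\<epsilon>} (\<lambda>s. lam (\<phi> s z))"
    and Q_kernel: "Q \<in> borel \<rightarrow>\<^sub>M prob_algebra borel"
    and Q_mixture: "\<And>z A. A \<in> sets borel \<Longrightarrow>
          lam z * measure (Q z) A = lr z * measure (Qr z) A + lb z * measure (Qb z) A"
    and Q_no_atom: "\<And>z. measure (Q z) {z} = 0"

locale assumption_W = pdmp_data X \<phi> lr lb lam Qr Qb Q
  for X :: "'z::banach \<Rightarrow> 'z"
    and \<phi> :: "real \<Rightarrow> 'z \<Rightarrow> 'z"
    and lr lb lam :: "'z \<Rightarrow> real"
    and Qr Qb Q :: "'z \<Rightarrow> 'z measure" +
  assumes W1: "lr \<in> borel_measurable borel" "lb \<in> borel_measurable borel"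
    and W2: "Qb \<in> borel \<rightarrow>\<^sub>M prob_algebra borel" "Qr \<in> borel \<rightarrow>\<^sub>M prob_algebra borel"
    and W3: "\<And>z. measure (Qb z) {y. norm y \<le> norm z} = 1"
    and W4: "\<And>\<epsilon>::real. 0 < \<epsilon> \<Longrightarrow> \<exists>R>0. \<forall>z\<in>ball 0 R. measure (Qr z) (ball 0 R) > 1 - \<epsilon>"
    and W5: "\<And>R::real. 0 < R \<Longrightarrow> bdd_above (lb ` ball 0 R)"
    and W6: "\<exists>M>0. \<forall>z. lr z \<le> M"
    and W7: "\<exists>c::real \<Rightarrow> real. continuous_on {0..} c \<and> (\<forall>t\<ge>0. 0 < c t) \<and>
               (\<forall>t\<ge>0. \<forall>z. norm (\<phi> t z) \<le> c t * (1 + norm z))"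
    and W8: "continuous_on UNIV lr" "continuous_on UNIV lb"
      "\<And>f::'z \<Rightarrow> real. f \<in> bcontfun \<Longrightarrow> continuous_on UNIV (\<lambda>z. \<integral>y. f y \<partial>Qb z)"
      "\<And>f::'z \<Rightarrow> real. f \<in> bcontfun \<Longrightarrow> continuous_on UNIV (\<lambda>z. \<integral>y. f y \<partial>Qr z)"


section \<open>The process and its semigroup\<close>

text \<open>A path is described by the post-jump states \<open>Y 0, Y 1, \<dots>\<close> (\<open>Y 0\<close> is the starting point) and
  the holding times \<open>S 0, S 1, \<dots>\<close>; \<open>S n\<close> is spent after the \<open>n\<close>-th jump and may be infinite.\<close>

definition jump_time :: "(nat \<Rightarrow> 'w \<Rightarrow> ennreal) \<Rightarrow> nat \<Rightarrow> 'w \<Rightarrow> ennreal" where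
  "jump_time S n \<omega> = (\<Sum>i<n. S i \<omega>)"

text \<open>The \<open>else\<close> branch concerns exploding paths only.\<close>

definition pdmp_path ::
  "(real \<Rightarrow> 'z \<Rightarrow> 'z) \<Rightarrow> (nat \<Rightarrow> 'w \<Rightarrow> ennreal) \<Rightarrow> (nat \<Rightarrow> 'w \<Rightarrow> 'z) \<Rightarrow> real \<Rightarrow> 'w \<Rightarrow> 'z" where
  "pdmp_path \<phi> S Y t \<omega> =
     (if \<exists>n. ennreal t < jump_time S (Suc n) \<omega>
      then let n = (LEAST n. ennreal t < jump_time S (Suc n) \<omega>)
           in \<phi> (t - enn2real (jump_time S n \<omega>)) (Y n \<omega>)
      else Y 0 \<omega>)"

text \<open>The \<open>\<sigma>\<close>-algebra generated by \<open>Y 0, \<dots>, Y n\<close> and \<open>S 0, \<dots>, S (k - 1)\<close>.\<close>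

definition jump_history ::
  "'w measure \<Rightarrow> (nat \<Rightarrow> 'w \<Rightarrow> ennreal) \<Rightarrow> (nat \<Rightarrow> 'w \<Rightarrow> 'z::topological_space) \<Rightarrow>
     nat \<Rightarrow> nat \<Rightarrow> 'w measure" where
  "jump_history M S Y n k =
     vimage_algebra (space M) (\<lambda>\<omega>. (\<lambda>i\<in>{..n}. Y i \<omega>, \<lambda>i\<in>{..<k}. S i \<omega>))
       ((\<Pi>\<^sub>M i\<in>{..n}. borel) \<Otimes>\<^sub>M (\<Pi>\<^sub>M i\<in>{..<k}. borel))"

text \<open>\<open>P z\<close> is the law under which the process starts from \<open>z\<close>. Conditionally on the past, each
  holding time and each post-jump state are distributed as for a process freshly started from the
  current state.\<close>

locale pdmp_process =
  fixes \<phi> :: "real \<Rightarrow> 'z::banach \<Rightarrow> 'z"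
    and lam :: "'z \<Rightarrow> real"
    and Q :: "'z \<Rightarrow> 'z measure"
    and P :: "'z \<Rightarrow> 'w measure"
    and S :: "nat \<Rightarrow> 'w \<Rightarrow> ennreal"
    and Y :: "nat \<Rightarrow> 'w \<Rightarrow> 'z"
  assumes prob_P: "\<And>z. prob_space (P z)"
    and S_measurable: "\<And>z n. S n \<in> borel_measurable (P z)"
    and Y_measurable: "\<And>z n. Y n \<in> borel_measurable (P z)"
    and path_measurable: "\<And>z t. 0 \<le> t \<Longrightarrow> pdmp_path \<phi> S Y t \<in> borel_measurable (P z)"
    and start: "\<And>z. AE \<omega> in P z. Y 0 \<omega> = z"
    and holding_time: "\<And>z n t. 0 \<le> t \<Longrightarrow>
          AE \<omega> in P z. real_cond_exp (P z) (jump_history (P z) S Y n n)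
              (indicator {\<omega> \<in> space (P z). ennreal t < S n \<omega>}) \<omega> =
            exp (- (LBINT s:{0..t}. lam (\<phi> s (Y n \<omega>))))"
    and post_jump: "\<And>z n A. A \<in> sets borel \<Longrightarrow>
          AE \<omega> in P z. S n \<omega> < \<infinity> \<longrightarrow>
            real_cond_exp (P z) (jump_history (P z) S Y n (Suc n))
              (indicator {\<omega> \<in> space (P z). Y (Suc n) \<omega> \<in> A}) \<omega> =
            measure (Q (\<phi> (enn2real (S n \<omega>)) (Y n \<omega>))) A"
    and nonexplosive: "\<And>z. AE \<omega> in P z. \<forall>t\<ge>0. \<exists>n. ennreal t < jump_time S n \<omega>"

definition pdmp_semigroup ::
  "(real \<Rightarrow> 'z \<Rightarrow> 'z) \<Rightarrow> ('z \<Rightarrow> 'w measure) \<Rightarrow> (nat \<Rightarrow> 'w \<Rightarrow> ennreal) \<Rightarrow> (nat \<Rightarrow> 'w \<Rightarrow> 'z) \<Rightarrow>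
     real \<Rightarrow> ('z \<Rightarrow> real) \<Rightarrow> 'z \<Rightarrow> real" where
  "pdmp_semigroup \<phi> P S Y t f z = (\<integral>\<omega>. f (pdmp_path \<phi> S Y t \<omega>) \<partial>P z)"


section \<open>The generator on \<open>C\<^sub>0\<close>\<close>

text \<open>Convergence in supremum norm is uniform convergence on the whole space.\<close>

definition C0 :: "(real \<Rightarrow> ('z \<Rightarrow> real) \<Rightarrow> 'z \<Rightarrow> real) \<Rightarrow> ('z::topological_space \<Rightarrow> real) set" where
  "C0 T = {f \<in> bcontfun. uniform_limit UNIV (\<lambda>t. T t f) f (at_right 0)}"

definition has_generator ::
  "(real \<Rightarrow> ('z \<Rightarrow> real) \<Rightarrow> 'z \<Rightarrow> real) \<Rightarrow> ('z::topological_space \<Rightarrow> real) \<Rightarrow> ('z \<Rightarrow> real) \<Rightarrow> bool" where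
  "has_generator T f h \<longleftrightarrow> f \<in> C0 T \<and> h \<in> C0 T \<and>
     uniform_limit UNIV (\<lambda>t z. (T t f z - f z) / t) h (at_right 0)"

definition generator_dom ::
  "(real \<Rightarrow> ('z \<Rightarrow> real) \<Rightarrow> 'z \<Rightarrow> real) \<Rightarrow> ('z::topological_space \<Rightarrow> real) set" where
  "generator_dom T = {f. \<exists>h. has_generator T f h}"

definition generator ::
  "(real \<Rightarrow> ('z \<Rightarrow> real) \<Rightarrow> 'z \<Rightarrow> real) \<Rightarrow> ('z::topological_space \<Rightarrow> real) \<Rightarrow> 'z \<Rightarrow> real" where
  "generator T f = (THE h. has_generator T f h)"


section \<open>The derivative along the flow as an operator in \<open>L\<^sup>2\<close>\<close>

text \<open>Elements of \<open>L\<^sup>2\<close> are represented by functions; values of operators are determined only up to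
  almost everywhere equality.\<close>

definition L2 :: "'z measure \<Rightarrow> ('z \<Rightarrow> real) set" where
  "L2 \<mu> = {f \<in> borel_measurable \<mu>. integrable \<mu> (\<lambda>z. (f z)\<^sup>2)}"

definition has_flow_deriv ::
  "(real \<Rightarrow> 'z \<Rightarrow> 'z) \<Rightarrow> 'z measure \<Rightarrow> ('z \<Rightarrow> real) \<Rightarrow> ('z \<Rightarrow> real) \<Rightarrow> bool" where
  "has_flow_deriv \<phi> \<mu> f g \<longleftrightarrow> f \<in> L2 \<mu> \<and> g \<in> L2 \<mu> \<and>
     (\<forall>\<^sub>F t in at_right 0. (\<lambda>z. f (\<phi> t z)) \<in> L2 \<mu>) \<and>
     ((\<lambda>t. \<integral>z. ((f (\<phi> t z) - f z) / t - g z)\<^sup>2 \<partial>\<mu>) \<longlongrightarrow> 0) (at_right 0)"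

definition LX_dom :: "(real \<Rightarrow> 'z \<Rightarrow> 'z) \<Rightarrow> 'z measure \<Rightarrow> ('z \<Rightarrow> real) set" where
  "LX_dom \<phi> \<mu> = {f. \<exists>g. has_flow_deriv \<phi> \<mu> f g}"

definition LX :: "(real \<Rightarrow> 'z \<Rightarrow> 'z) \<Rightarrow> 'z measure \<Rightarrow> ('z \<Rightarrow> real) \<Rightarrow> 'z \<Rightarrow> real" where
  "LX \<phi> \<mu> f = (SOME g. has_flow_deriv \<phi> \<mu> f g)"

text \<open>For an operator \<open>A\<close> with domain \<open>D\<close>: \<open>h\<close> lies in the domain of the adjoint and \<open>A\<^sup>* h = k\<close>.
  The function \<open>k\<close> is unique up to null sets when \<open>D\<close> is dense.\<close>

definition has_L2_adjoint ::
  "'z measure \<Rightarrow> ('z \<Rightarrow> real) set \<Rightarrow> (('z \<Rightarrow> real) \<Rightarrow> 'z \<Rightarrow> real) \<Rightarrow>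
     ('z \<Rightarrow> real) \<Rightarrow> ('z \<Rightarrow> real) \<Rightarrow> bool" where
  "has_L2_adjoint \<mu> D A h k \<longleftrightarrow> h \<in> L2 \<mu> \<and> k \<in> L2 \<mu> \<and>
     (\<forall>f\<in>D. (\<integral>z. A f z * h z \<partial>\<mu>) = (\<integral>z. f z * k z \<partial>\<mu>))"


section \<open>The reversed kernel and the target measure\<close>

text \<open>Unlike \<open>Q\<close>, the kernel \<open>Q\<^sup>*\<close> need not be Markov: the defining identity forces
  \<open>Q\<^sup>*(y, \<Z>)\<close> to be the density at \<open>y\<close> of \<open>\<mu>\<^sub>0 Q\<close> with respect to \<open>\<mu>\<^sub>0\<close>, which is \<open>1\<close> only if \<open>\<mu>\<^sub>0\<close> is
  \<open>Q\<close>-invariant.\<close>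

definition finite_kernel :: "('z::topological_space \<Rightarrow> 'z measure) \<Rightarrow> bool" where
  "finite_kernel K \<longleftrightarrow> (\<forall>z. finite_measure (K z) \<and> sets (K z) = sets borel) \<and>
     (\<forall>A\<in>sets borel. (\<lambda>z. measure (K z) A) \<in> borel_measurable borel)"

definition reversed_kernel ::
  "'z::topological_space measure \<Rightarrow> ('z \<Rightarrow> 'z measure) \<Rightarrow> ('z \<Rightarrow> 'z measure) \<Rightarrow> bool" where
  "reversed_kernel \<mu>0 Q Qs \<longleftrightarrow> finite_kernel Qs \<and>
     (\<forall>g::'z \<times> 'z \<Rightarrow> real. g \<in> bcontfun \<longrightarrow>
        (\<integral>y. (\<integral>z. g (y, z) \<partial>Qs y) \<partial>\<mu>0) = (\<integral>z. (\<integral>y. g (y, z) \<partial>Q z) \<partial>\<mu>0))"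

definition lower_semicontinuous :: "('z::topological_space \<Rightarrow> real) \<Rightarrow> bool" where
  "lower_semicontinuous F \<longleftrightarrow> (\<forall>z. \<forall>a<F z. \<forall>\<^sub>F y in nhds z. a < F y)"

definition gibbs_measure :: "'z measure \<Rightarrow> ('z \<Rightarrow> real) \<Rightarrow> 'z measure" where
  "gibbs_measure \<mu>0 \<Phi> = density \<mu>0 (\<lambda>z. ennreal (exp (- \<Phi> z) / (\<integral>x. exp (- \<Phi> x) \<partial>\<mu>0)))"

end

(* For every z, the difference quotients (f (phi_t z) - f z) / t converge to L f - lam * (Q f - f):
   f in C_0 controls f (phi_r y) - f y by sup |P_r f - f| + 2 ||f|| * cum_rate r y, which replaces the
   Markov property at the first jump, and weak continuity of lam * Q keeps the state after the first
   jump in a ball where the rate is bounded. The pointwise limit is the L^2 limit almost everywhere.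
   Integrating against exp (- Phi), the adjoint relation (also for f = 1) and the reversed kernel
   give zero. *)
theory Submission
  imports Defs
begin

section \<open>Kernels and their reversal\<close>

text \<open>Three obstacles shape the proof. The process is given only through the conditional laws
  of single holding times and single post-jump states, without a Markov property of its semigroup or
  a formula for the generator; that formula is derived from paths with at most one jump up to a
  small time. Where \<open>lam z = 0\<close> the mixture identity says nothing about
  \<open>Q z\<close>, so only the product of \<open>lam\<close> and \<open>Q\<close> is continuous,
  and such points need an estimate of their own. Finally, \<open>lam * exp (- \<Phi>)\<close> may
  have infinite integral, so \<open>Q f\<close> and \<open>f\<close> cannot be integrated separately
  against it. The integral of their difference exists all the same: almost everywhere the integrand
  is \<open>exp (- \<Phi>)\<close> times the bounded function \<open>generator T f\<close>, minus
  \<open>exp (- \<Phi>)\<close> times the flow derivative, a product of two square-integrable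
  functions. The exchange of \<open>Q\<close> and its reversal is made on balls, where the remainder
  is a flux of mass through the sphere. Its outward part is governed by the bounded refreshment
  rate, because reflections do not increase the norm.\<close>

lemma nn_integral_le_1:
  fixes f :: "'a \<Rightarrow> ennreal"
  assumes "prob_space M" "\<And>x. f x \<le> 1"
  shows "(\<integral>\<^sup>+x. f x \<partial>M) \<le> 1"
proof -
  have "(\<integral>\<^sup>+x. f x \<partial>M) \<le> (\<integral>\<^sup>+x. 1 \<partial>M)" by (intro nn_integral_mono assms)
  then show ?thesis using prob_space.emeasure_space_1[OF assms(1)] by simp
qed

text \<open>Open sets form an intersection-stable generator of the Borel sets, and on a metric space
  the indicator of an open set is an increasing limit of truncated multiples of the distance to its
  complement. Finiteness of \<open>M\<close> lets the whole space serve as exhausting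
  sequence.\<close>

lemma measure_eqI_cont:
  fixes M N :: "'a::metric_space measure"
  assumes sM: "sets M = sets borel" and sN: "sets N = sets borel"
    and fin: "emeasure M UNIV \<noteq> \<infinity>"
    and eq: "\<And>f::'a \<Rightarrow> real. continuous_on UNIV f \<Longrightarrow> (\<And>x. 0 \<le> f x) \<Longrightarrow> (\<And>x. f x \<le> 1) \<Longrightarrow>
        (\<integral>\<^sup>+x. ennreal (f x) \<partial>M) = (\<integral>\<^sup>+x. ennreal (f x) \<partial>N)"
  shows "M = N"
proof (rule measure_eqI_generator_eq[where E="{U. open U}" and \<Omega>=UNIV and A="\<lambda>_. UNIV"])
  show "Int_stable {U::'a set. open U}" by (auto simp: Int_stable_def)
  show "sets M = sigma_sets UNIV {U. open U}" by (simp add: sM borel_def)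
  show "sets N = sigma_sets UNIV {U. open U}" by (simp add: sN borel_def)
  fix U :: "'a set" assume "U \<in> {U. open U}"
  then have U: "open U" by simp
  \<comment> \<open>\<open>infdist\<close> to the empty set is \<open>0\<close> by convention, so
    the distance formula would fail for \<open>U = UNIV\<close>.\<close>
  define c where "c = (\<lambda>n x. if U = UNIV then 1 else min 1 (real n * infdist x (-U)))"
  have cont: "continuous_on UNIV (c n)" for n
    unfolding c_def by (cases "U = UNIV") (auto intro!: continuous_intros)
  have c0: "0 \<le> c n x" and c1: "c n x \<le> 1" for n x
    by (auto simp: c_def infdist_nonneg)
  have inc: "incseq (\<lambda>n x. ennreal (c n x))"
    by (auto simp: incseq_def le_fun_def c_def intro!: ennreal_leI min.mono mult_right_mono infdist_nonneg)
  have sup: "(SUP n. ennreal (c n x)) = indicator U x" for x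
  proof (cases "U = UNIV")
    case True then show ?thesis by (simp add: c_def)
  next
    case False
    have ne: "-U \<noteq> {}" using False by auto
    have lim: "(\<lambda>n. c n x) \<longlonglongrightarrow> indicator U x"
    proof (cases "x \<in> U")
      case True
      have "infdist x (-U) \<noteq> 0"
        using in_closed_iff_infdist_zero[of "-U" x] U ne True by auto
      then have pos: "infdist x (-U) > 0" using infdist_nonneg[of x "-U"] by linarith
      obtain m :: nat where m: "1 < real m * infdist x (-U)"
        using reals_Archimedean3[OF pos] by blast
      have "\<forall>\<^sub>F n in sequentially. c n x = 1"
        using eventually_ge_at_top[of m]
      proof eventually_elim
        case (elim n)
        have "real m * infdist x (-U) \<le> real n * infdist x (-U)"
          using elim pos by (intro mult_right_mono) auto
        then show ?case using m False by (simp add: c_def)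
      qed
      then show ?thesis using True by (simp add: tendsto_eventually)
    next
      case x: False
      then have "c n x = 0" for n using False by (simp add: c_def)
      then show ?thesis using x by simp
    qed
    have "(\<lambda>n. ennreal (c n x)) \<longlonglongrightarrow> (SUP n. ennreal (c n x))"
      by (rule LIMSEQ_SUP) (use inc in \<open>auto simp: incseq_def le_fun_def\<close>)
    moreover have "(\<lambda>n. ennreal (c n x)) \<longlonglongrightarrow> ennreal (indicator U x)"
      by (intro tendsto_ennrealI lim)
    ultimately show ?thesis using LIMSEQ_unique by (metis ennreal_indicator)
  qed
  have *: "emeasure L U = (SUP n. \<integral>\<^sup>+x. ennreal (c n x) \<partial>L)" if L: "sets L = sets borel" for L
  proof -
    have m: "(\<lambda>x. ennreal (c n x)) \<in> borel_measurable L" for n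
      using borel_measurable_continuous_onI[OF cont] by (simp add: measurable_cong_sets[OF L refl])
    have "emeasure L U = (\<integral>\<^sup>+x. (SUP n. ennreal (c n x)) \<partial>L)"
      using U L by (simp add: sup)
    also have "\<dots> = (SUP n. \<integral>\<^sup>+x. ennreal (c n x) \<partial>L)"
      by (rule nn_integral_monotone_convergence_SUP[OF inc m])
    finally show ?thesis .
  qed
  show "emeasure M U = emeasure N U"
    by (simp add: *[OF sM] *[OF sN] eq[OF cont c0 c1])
qed (use fin in auto)

text \<open>One interface for the Markov kernel \<open>Q\<close>, the finite kernel
  \<open>Qs\<close> and the kernel met at the first jump on the path space; hence an arbitrary base
  measure and no condition on the total mass.\<close>

definition meas_kernel :: "'a measure \<Rightarrow> ('a \<Rightarrow> 'b::topological_space measure) \<Rightarrow> bool" where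
  "meas_kernel M K \<longleftrightarrow> (\<forall>x. sets (K x) = sets borel) \<and>
     (\<forall>B\<in>sets borel. (\<lambda>x. emeasure (K x) B) \<in> borel_measurable M)"

lemma nn_integral_kernel_measurable:
  assumes K: "meas_kernel M K" and b: "b \<in> borel_measurable borel"
  shows "(\<lambda>x. \<integral>\<^sup>+y. b y \<partial>K x) \<in> borel_measurable M"
  using b
proof (induction rule: borel_measurable_induct)
  have s: "sets (K x) = sets borel" for x using K by (simp add: meas_kernel_def)
  have m: "g \<in> borel_measurable (K x)" if "g \<in> borel_measurable borel" for g :: "_ \<Rightarrow> ennreal" and x
    using that by (simp add: measurable_cong_sets[OF s refl])
  {
    case (cong f g) then have "f = g" by (intro ext) simp
    then show ?case using cong by simp
  next
    case (set A)
    then show ?case using K by (simp add: meas_kernel_def s)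
  next
    case (mult u c)
    then show ?case by (simp add: nn_integral_cmult m)
  next
    case (add u v)
    then show ?case by (simp add: nn_integral_add m)
  next
    case (seq U)
    have "(\<lambda>x. \<integral>\<^sup>+y. (SUP i. U i) y \<partial>K x) = (\<lambda>x. SUP i. \<integral>\<^sup>+y. U i y \<partial>K x)"
      using seq by (intro ext) (simp add: SUP_apply image_image nn_integral_monotone_convergence_SUP m)
    then show ?case using seq by simp
  }
qed

text \<open>The second marginal of \<open>a(x) M(dx) K(x, dy)\<close>. As a measure it turns
  identities between double integrals into equalities of measures, which can be tested on few
  functions.\<close>

definition kernel_mix ::
  "'a measure \<Rightarrow> ('a \<Rightarrow> ennreal) \<Rightarrow> ('a \<Rightarrow> 'b::topological_space measure) \<Rightarrow> 'b measure" where
  "kernel_mix M a K = measure_of UNIV (sets borel) (\<lambda>B. \<integral>\<^sup>+x. a x * emeasure (K x) B \<partial>M)"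

lemma sets_kernel_mix [simp]: "sets (kernel_mix M a K) = sets borel"
  unfolding kernel_mix_def by (simp add: sets.sigma_sets_eq[of borel, simplified])

lemma emeasure_kernel_mix:
  assumes K: "meas_kernel M K" and a: "a \<in> borel_measurable M" and B: "B \<in> sets borel"
  shows "emeasure (kernel_mix M a K) B = (\<integral>\<^sup>+x. a x * emeasure (K x) B \<partial>M)"
proof (rule emeasure_measure_of[OF kernel_mix_def])
  have s: "sets (K x) = sets borel" for x using K by (simp add: meas_kernel_def)
  have m: "(\<lambda>x. emeasure (K x) B) \<in> borel_measurable M" if "B \<in> sets borel" for B
    using K that by (simp add: meas_kernel_def)
  show "sets borel \<subseteq> Pow (UNIV::'b set)" by simp
  show "B \<in> sets (kernel_mix M a K)" using B by simp
  show "positive (sets (kernel_mix M a K)) (\<lambda>B. \<integral>\<^sup>+x. a x * emeasure (K x) B \<partial>M)"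
    by (simp add: positive_def)
  show "countably_additive (sets (kernel_mix M a K)) (\<lambda>B. \<integral>\<^sup>+x. a x * emeasure (K x) B \<partial>M)"
  proof (rule countably_additiveI)
    fix F :: "nat \<Rightarrow> 'b set"
    assume F: "range F \<subseteq> sets (kernel_mix M a K)" "disjoint_family F"
    have F': "F i \<in> sets borel" for i using F by auto
    have "(\<Sum>i. \<integral>\<^sup>+x. a x * emeasure (K x) (F i) \<partial>M) = (\<integral>\<^sup>+x. (\<Sum>i. a x * emeasure (K x) (F i)) \<partial>M)"
      using a m[OF F'] by (intro nn_integral_suminf[symmetric]) measurable
    also have "\<dots> = (\<integral>\<^sup>+x. a x * emeasure (K x) (\<Union>i. F i) \<partial>M)"
      using F by (intro nn_integral_cong) (simp add: suminf_emeasure s)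
    finally show "(\<Sum>i. \<integral>\<^sup>+x. a x * emeasure (K x) (F i) \<partial>M) = (\<integral>\<^sup>+x. a x * emeasure (K x) (\<Union>i. F i) \<partial>M)" .
  qed
qed

lemma nn_integral_kernel_mix:
  assumes K: "meas_kernel M K" and a: "a \<in> borel_measurable M" and b: "b \<in> borel_measurable borel"
  shows "(\<integral>\<^sup>+y. b y \<partial>kernel_mix M a K) = (\<integral>\<^sup>+x. a x * (\<integral>\<^sup>+y. b y \<partial>K x) \<partial>M)"
  using b
proof (induction rule: borel_measurable_induct)
  have s: "sets (K x) = sets borel" for x using K by (simp add: meas_kernel_def)
  have m: "g \<in> borel_measurable (K x)" if "g \<in> borel_measurable borel" for g :: "_ \<Rightarrow> ennreal" and x
    using that by (simp add: measurable_cong_sets[OF s refl])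
  have m': "g \<in> borel_measurable (kernel_mix M a K)" if "g \<in> borel_measurable borel" for g :: "_ \<Rightarrow> ennreal"
    using that by (simp add: measurable_cong_sets[OF sets_kernel_mix refl])
  note [measurable] = a nn_integral_kernel_measurable[OF K]
  {
    case (cong f g) then have "f = g" by (intro ext) simp
    then show ?case using cong by simp
  next
    case (set A)
    then show ?case by (simp add: s emeasure_kernel_mix[OF K a])
  next
    case (mult u c)
    have "(\<integral>\<^sup>+y. c * u y \<partial>kernel_mix M a K) = c * (\<integral>\<^sup>+y. u y \<partial>kernel_mix M a K)"
      using mult by (simp add: nn_integral_cmult m')
    also have "\<dots> = (\<integral>\<^sup>+x. c * (a x * (\<integral>\<^sup>+y. u y \<partial>K x)) \<partial>M)"
      using mult by (subst nn_integral_cmult) auto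
    finally show ?case using mult by (simp add: nn_integral_cmult m mult.left_commute)
  next
    case (add u v)
    have "(\<integral>\<^sup>+y. u y + v y \<partial>kernel_mix M a K) = (\<integral>\<^sup>+y. u y \<partial>kernel_mix M a K) + (\<integral>\<^sup>+y. v y \<partial>kernel_mix M a K)"
      using add by (simp add: nn_integral_add m')
    also have "\<dots> = (\<integral>\<^sup>+x. a x * (\<integral>\<^sup>+y. u y \<partial>K x) + a x * (\<integral>\<^sup>+y. v y \<partial>K x) \<partial>M)"
      using add by (subst nn_integral_add) auto
    finally show ?case using add by (simp add: nn_integral_add m distrib_left add.commute)
  next
    case (seq U)
    have 1: "(\<integral>\<^sup>+y. (SUP i. U i) y \<partial>L) = (SUP i. \<integral>\<^sup>+y. U i y \<partial>L)"
      if "\<And>i. U i \<in> borel_measurable L" for L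
      using seq that by (simp add: SUP_apply image_image nn_integral_monotone_convergence_SUP)
    have inc: "incseq (\<lambda>i x. a x * (\<integral>\<^sup>+y. U i y \<partial>K x))"
      using \<open>incseq U\<close> by (auto simp: incseq_def le_fun_def intro!: mult_left_mono nn_integral_mono)
    have "(\<integral>\<^sup>+y. (SUP i. U i) y \<partial>kernel_mix M a K) = (SUP i. \<integral>\<^sup>+x. a x * (\<integral>\<^sup>+y. U i y \<partial>K x) \<partial>M)"
      using seq 1[of "kernel_mix M a K"] by (simp add: m' del: SUP_apply)
    also have "\<dots> = (\<integral>\<^sup>+x. (SUP i. a x * (\<integral>\<^sup>+y. U i y \<partial>K x)) \<partial>M)"
      using seq by (intro nn_integral_monotone_convergence_SUP[symmetric] inc) auto
    also have "\<dots> = (\<integral>\<^sup>+x. a x * (\<integral>\<^sup>+y. (SUP i. U i) y \<partial>K x) \<partial>M)"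
      using seq by (intro nn_integral_cong) (subst 1, auto simp: m SUP_mult_left_ennreal)
    finally show ?case .
  }
qed

lemma meas_kernel_prob_algebra:
  assumes "K \<in> M \<rightarrow>\<^sub>M prob_algebra borel" and "\<And>x. x \<in> space M"
  shows "meas_kernel M K"
proof -
  have 1: "K x \<in> space (prob_algebra borel)" for x using measurable_space[OF assms(1)] assms(2) by blast
  have "sets (K x) = sets borel" for x using 1[of x] by (simp add: space_prob_algebra)
  moreover have "(\<lambda>x. emeasure (K x) B) \<in> borel_measurable M" if "B \<in> sets borel" for B
    using measurable_compose[OF measurable_prob_algebraD[OF assms(1)] measurable_emeasure_subprob_algebra[OF that]] .
  ultimately show ?thesis by (simp add: meas_kernel_def)
qed

lemma meas_kernel_finite_kernel:
  assumes "finite_kernel K" and M: "sets M = sets borel"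
  shows "meas_kernel M K"
proof -
  have "(\<lambda>x. emeasure (K x) B) \<in> borel_measurable M" if "B \<in> sets borel" for B
  proof -
    have "emeasure (K x) B = ennreal (measure (K x) B)" for x
      using assms(1) by (simp add: finite_kernel_def finite_measure.emeasure_eq_measure)
    then show ?thesis using assms that
      by (auto simp: finite_kernel_def measurable_cong_sets[OF M refl])
  qed
  then show ?thesis using assms by (simp add: meas_kernel_def finite_kernel_def)
qed

section \<open>The reversal identity for nonnegative measurable functions\<close>

lemma integrable_cont_unit:
  fixes f :: "'a::topological_space \<Rightarrow> real"
  assumes "finite_measure M" "sets M = sets borel" "continuous_on UNIV f"
    "\<And>x. 0 \<le> f x" "\<And>x. f x \<le> 1"
  shows "integrable M f"
proof -
  interpret finite_measure M by fact
  have "f \<in> borel_measurable M"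
    using borel_measurable_continuous_onI[OF assms(3)] by (simp add: measurable_cong_sets[OF assms(2) refl])
  then show ?thesis using assms(4,5) by (intro integrable_const_bound[of _ 1]) auto
qed

text \<open>The defining identity is applied to the product \<open>a y * b z\<close>. The work lies
  in passing from Bochner integrals to nonnegative ones, where the later extension needs no
  integrability.\<close>

lemma reversed_kernel_nn_cont:
  fixes \<mu> :: "'z::metric_space measure" and a b :: "'z \<Rightarrow> real"
  assumes \<mu>: "prob_space \<mu>" "sets \<mu> = sets borel"
    and Q: "Q \<in> borel \<rightarrow>\<^sub>M prob_algebra borel"
    and rev: "reversed_kernel \<mu> Q Qs"
    and a: "continuous_on UNIV a" "\<And>x. 0 \<le> a x" "\<And>x. a x \<le> 1"
    and b: "continuous_on UNIV b" "\<And>x. 0 \<le> b x" "\<And>x. b x \<le> 1"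
  shows "(\<integral>\<^sup>+y. ennreal (a y) * (\<integral>\<^sup>+z. ennreal (b z) \<partial>Qs y) \<partial>\<mu>) =
         (\<integral>\<^sup>+z. ennreal (b z) * (\<integral>\<^sup>+y. ennreal (a y) \<partial>Q z) \<partial>\<mu>)"
proof -
  interpret \<mu>: prob_space \<mu> by fact
  have fk: "finite_kernel Qs" using rev by (simp add: reversed_kernel_def)
  have Qp: "prob_space (Q z)" "sets (Q z) = sets borel" for z
    using measurable_space[OF Q, of z] by (auto simp: space_prob_algebra)
  have fQs: "finite_measure (Qs z)" "sets (Qs z) = sets borel" for z
    using fk by (auto simp: finite_kernel_def)
  have fQ: "finite_measure (Q z)" for z using Qp(1) by (rule prob_space.finite_measure)
  have iQs: "integrable (Qs z) b" for z by (intro integrable_cont_unit fQs b)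
  have iQ: "integrable (Q z) a" for z by (intro integrable_cont_unit fQ Qp a)
  have nQs: "(\<integral>\<^sup>+x. ennreal (b x) \<partial>Qs z) = ennreal (\<integral>x. b x \<partial>Qs z)" for z
    by (rule nn_integral_eq_integral) (use iQs b in auto)
  have nQ: "(\<integral>\<^sup>+x. ennreal (a x) \<partial>Q z) = ennreal (\<integral>x. a x \<partial>Q z)" for z
    by (rule nn_integral_eq_integral) (use iQ a in auto)
  have id: "(\<integral>y. (\<integral>z. g (y, z) \<partial>Qs y) \<partial>\<mu>) = (\<integral>z. (\<integral>y. g (y, z) \<partial>Q z) \<partial>\<mu>)"
    if "g \<in> bcontfun" for g :: "'z \<times> 'z \<Rightarrow> real"
    using rev that by (simp add: reversed_kernel_def)
  have "(\<integral>y. measure (Qs y) UNIV \<partial>\<mu>) = 1"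
  proof -
    have "(\<lambda>_. 1) \<in> (bcontfun :: ('z \<times> 'z \<Rightarrow> real) set)" by (simp add: const_bcontfun)
    from id[OF this] show ?thesis
      using sets_eq_imp_space_eq[OF fQs(2)] sets_eq_imp_space_eq[OF Qp(2)] prob_space.prob_space[OF Qp(1)]
      by (simp add: \<mu>.prob_space)
  qed
  \<comment> \<open>\<open>Qs\<close> is only pointwise finite. A non-integrable function has
    Bochner integral \<open>0\<close> by default, so the value \<open>1\<close> proves that the
    total mass is integrable.\<close>
  then have imass: "integrable \<mu> (\<lambda>y. measure (Qs y) UNIV)"
    using not_integrable_integral_eq by fastforce
  have bint: "0 \<le> (\<integral>x. b x \<partial>Qs z)" "(\<integral>x. b x \<partial>Qs z) \<le> measure (Qs z) UNIV" for z
  proof -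
    show "0 \<le> (\<integral>x. b x \<partial>Qs z)" using b by simp
    interpret finite_measure "Qs z" by (rule fQs)
    have "(\<integral>x. b x \<partial>Qs z) \<le> (\<integral>x. 1 \<partial>Qs z)"
      by (intro integral_mono iQs) (use b in auto)
    then show "(\<integral>x. b x \<partial>Qs z) \<le> measure (Qs z) UNIV"
      using sets_eq_imp_space_eq[OF fQs(2)] by simp
  qed
  have aint: "0 \<le> (\<integral>x. a x \<partial>Q z)" "(\<integral>x. a x \<partial>Q z) \<le> 1" for z
  proof -
    show "0 \<le> (\<integral>x. a x \<partial>Q z)" using a by simp
    interpret prob_space "Q z" by (rule Qp)
    have "(\<integral>x. a x \<partial>Q z) \<le> (\<integral>x. 1 \<partial>Q z)"
      by (intro integral_mono iQ) (use a in auto)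
    then show "(\<integral>x. a x \<partial>Q z) \<le> 1" by (simp add: prob_space)
  qed
  have mb: "(\<lambda>y. \<integral>x. b x \<partial>Qs y) \<in> borel_measurable \<mu>"
  proof -
    have "(\<lambda>y. enn2real (\<integral>\<^sup>+x. ennreal (b x) \<partial>Qs y)) \<in> borel_measurable \<mu>"
      using nn_integral_kernel_measurable[OF meas_kernel_finite_kernel[OF fk \<mu>(2)],
          of "\<lambda>x. ennreal (b x)"] borel_measurable_continuous_onI[OF b(1)] by simp
    then show ?thesis using bint by (simp add: nQs)
  qed
  have ma: "(\<lambda>y. \<integral>x. a x \<partial>Q y) \<in> borel_measurable \<mu>"
  proof -
    have "(\<lambda>y. enn2real (\<integral>\<^sup>+x. ennreal (a x) \<partial>Q y)) \<in> borel_measurable borel"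
      using nn_integral_kernel_measurable[OF meas_kernel_prob_algebra[OF Q],
          of "\<lambda>x. ennreal (a x)"] borel_measurable_continuous_onI[OF a(1)] by simp
    then show ?thesis using aint by (simp add: nQ measurable_cong_sets[OF \<mu>(2) refl])
  qed
  have am: "a \<in> borel_measurable \<mu>" "b \<in> borel_measurable \<mu>"
    using borel_measurable_continuous_onI[OF a(1)] borel_measurable_continuous_onI[OF b(1)]
    by (simp_all add: measurable_cong_sets[OF \<mu>(2) refl])
  have i1: "integrable \<mu> (\<lambda>y. a y * (\<integral>z. b z \<partial>Qs y))"
  proof (rule Bochner_Integration.integrable_bound[OF imass])
    have "a y * (\<integral>z. b z \<partial>Qs y) \<le> measure (Qs y) UNIV" for y
      using mult_left_le_one_le[OF bint(1) a(2,3)] bint(2) order.trans by blast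
    then show "AE y in \<mu>. norm (a y * (\<integral>z. b z \<partial>Qs y)) \<le> norm (measure (Qs y) UNIV)"
      using a(2) bint(1) by (simp add: abs_mult)
  qed (use am mb in measurable)
  have i2: "integrable \<mu> (\<lambda>z. b z * (\<integral>y. a y \<partial>Q z))"
  proof (rule \<mu>.integrable_const_bound[of _ 1])
    have "b z * (\<integral>y. a y \<partial>Q z) \<le> 1" for z
      by (intro mult_le_one b aint)
    then show "AE z in \<mu>. norm (b z * (\<integral>y. a y \<partial>Q z)) \<le> 1"
      using b(2) aint(1) by (simp add: abs_mult)
  qed (use am ma in measurable)
  have g: "(\<lambda>p. a (fst p) * b (snd p)) \<in> bcontfun"
  proof (rule bcontfun_normI[where b=1])
    show "continuous_on UNIV (\<lambda>p. a (fst p) * b (snd p))"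
      by (intro continuous_intros continuous_on_compose2[OF a(1)] continuous_on_compose2[OF b(1)]) auto
  qed (use a b in \<open>auto simp: abs_mult intro!: mult_le_one\<close>)
  have "(\<integral>\<^sup>+y. ennreal (a y) * (\<integral>\<^sup>+z. ennreal (b z) \<partial>Qs y) \<partial>\<mu>) = ennreal (\<integral>y. a y * (\<integral>z. b z \<partial>Qs y) \<partial>\<mu>)"
    using i1 a bint by (subst nn_integral_eq_integral[symmetric]) (auto simp: nQs ennreal_mult)
  also have "(\<integral>y. a y * (\<integral>z. b z \<partial>Qs y) \<partial>\<mu>) = (\<integral>z. b z * (\<integral>y. a y \<partial>Q z) \<partial>\<mu>)"
    using id[OF g] by (simp add: mult.commute)
  also have "ennreal \<dots> = (\<integral>\<^sup>+z. ennreal (b z) * (\<integral>\<^sup>+y. ennreal (a y) \<partial>Q z) \<partial>\<mu>)"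
    using i2 b aint by (subst nn_integral_eq_integral[symmetric]) (auto simp: nQ ennreal_mult)
  finally show ?thesis .
qed

text \<open>The two functions are generalised in turn, each time by an equality of measures.
  Recognising a measure by continuous test functions requires finiteness, so the function that stays
  fixed is kept bounded: first continuous and at most \<open>1\<close>, then an indicator. Only the
  last passage compares possibly infinite measures, and by then their values on all Borel sets are
  known.\<close>

lemma reversed_kernel_nn:
  fixes \<mu> :: "'z::metric_space measure" and a b :: "'z \<Rightarrow> ennreal"
  assumes \<mu>: "prob_space \<mu>" "sets \<mu> = sets borel"
    and Q: "Q \<in> borel \<rightarrow>\<^sub>M prob_algebra borel"
    and rev: "reversed_kernel \<mu> Q Qs"
    and a: "a \<in> borel_measurable borel" and b: "b \<in> borel_measurable borel"
  shows "(\<integral>\<^sup>+y. a y * (\<integral>\<^sup>+z. b z \<partial>Qs y) \<partial>\<mu>) = (\<integral>\<^sup>+z. b z * (\<integral>\<^sup>+y. a y \<partial>Q z) \<partial>\<mu>)"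
proof -
  interpret \<mu>: prob_space \<mu> by fact
  have Qp: "prob_space (Q z)" "sets (Q z) = sets borel" for z
    using measurable_space[OF Q, of z] by (auto simp: space_prob_algebra)
  have Qs: "meas_kernel \<mu> Qs" 
    using rev by (intro meas_kernel_finite_kernel) (auto simp: reversed_kernel_def \<mu>)
  have Q': "meas_kernel \<mu> Q"
    using meas_kernel_prob_algebra[OF Q] by (simp add: meas_kernel_def measurable_cong_sets[OF \<mu>(2) refl])
  have mm: "f \<in> borel_measurable \<mu>" if "f \<in> borel_measurable borel" for f :: "'z \<Rightarrow> ennreal"
    using that by (simp add: measurable_cong_sets[OF \<mu>(2) refl])
  note mQ = nn_integral_kernel_measurable[OF Q']
  have nn_dens: "(\<integral>\<^sup>+x. g x \<partial>density \<mu> f) = (\<integral>\<^sup>+x. g x * f x \<partial>\<mu>)"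
    if "f \<in> borel_measurable \<mu>" "g \<in> borel_measurable borel" for f g :: "'z \<Rightarrow> ennreal"
    by (subst nn_integral_density[OF that(1) mm[OF that(2)]]) (simp add: mult.commute)
  have cm: "(\<lambda>x. ennreal (f x)) \<in> borel_measurable borel" if "continuous_on UNIV f" for f :: "'z \<Rightarrow> real"
    using borel_measurable_continuous_onI[OF that] by simp
  have 1: "(\<integral>\<^sup>+y. ennreal (c y) * (\<integral>\<^sup>+z. b z \<partial>Qs y) \<partial>\<mu>) = (\<integral>\<^sup>+z. b z * (\<integral>\<^sup>+y. ennreal (c y) \<partial>Q z) \<partial>\<mu>)"
    if c: "continuous_on UNIV c" "\<And>x. 0 \<le> c x" "\<And>x. c x \<le> 1" and b: "b \<in> borel_measurable borel"
    for c :: "'z \<Rightarrow> real" and b :: "'z \<Rightarrow> ennreal"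
  proof -
    have "density \<mu> (\<lambda>z. \<integral>\<^sup>+y. ennreal (c y) \<partial>Q z) = kernel_mix \<mu> (\<lambda>y. ennreal (c y)) Qs"
    proof (rule measure_eqI_cont)
      have "(\<integral>\<^sup>+y. ennreal (c y) \<partial>Q z) \<le> 1" for z
        using c(3) by (intro nn_integral_le_1 Qp) (simp add: ennreal_le_1)
      then have "(\<integral>\<^sup>+z. (\<integral>\<^sup>+y. ennreal (c y) \<partial>Q z) \<partial>\<mu>) \<le> 1"
        by (rule nn_integral_le_1[OF \<mu>(1)])
      moreover have "emeasure (density \<mu> (\<lambda>z. \<integral>\<^sup>+y. ennreal (c y) \<partial>Q z)) UNIV = (\<integral>\<^sup>+z. (\<integral>\<^sup>+y. ennreal (c y) \<partial>Q z) \<partial>\<mu>)"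
        using \<mu> by (subst emeasure_density) (auto intro!: mQ cm c)
      ultimately show "emeasure (density \<mu> (\<lambda>z. \<integral>\<^sup>+y. ennreal (c y) \<partial>Q z)) UNIV \<noteq> \<infinity>"
        by (auto simp: top_unique)
      fix f :: "'z \<Rightarrow> real"
      assume f: "continuous_on UNIV f" "\<And>x. 0 \<le> f x" "\<And>x. f x \<le> 1"
      show "(\<integral>\<^sup>+x. ennreal (f x) \<partial>density \<mu> (\<lambda>z. \<integral>\<^sup>+y. ennreal (c y) \<partial>Q z)) =
            (\<integral>\<^sup>+x. ennreal (f x) \<partial>kernel_mix \<mu> (\<lambda>y. ennreal (c y)) Qs)"
        using reversed_kernel_nn_cont[OF \<mu> Q rev c f]
        by (simp add: nn_dens[OF mQ[OF cm[OF c(1)]] cm[OF f(1)]]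
            nn_integral_kernel_mix[OF Qs mm[OF cm[OF c(1)]] cm[OF f(1)]])
    qed (simp_all add: \<mu>)
    then have "(\<integral>\<^sup>+z. b z \<partial>density \<mu> (\<lambda>z. \<integral>\<^sup>+y. ennreal (c y) \<partial>Q z)) = (\<integral>\<^sup>+z. b z \<partial>kernel_mix \<mu> (\<lambda>y. ennreal (c y)) Qs)"
      by simp
    then show ?thesis
      by (simp add: nn_dens[OF mQ[OF cm[OF c(1)]] b]
          nn_integral_kernel_mix[OF Qs mm[OF cm[OF c(1)]] b])
  qed
  have 2: "(\<integral>\<^sup>+y. a y * emeasure (Qs y) B \<partial>\<mu>) = (\<integral>\<^sup>+z. indicator B z * (\<integral>\<^sup>+y. a y \<partial>Q z) \<partial>\<mu>)"
    if B: "B \<in> sets borel" for B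
  proof -
    have iB: "indicator B \<in> borel_measurable borel" using B by simp
    have eB: "(\<integral>\<^sup>+z. indicator B z \<partial>Qs y) = emeasure (Qs y) B" for y
      using B Qs by (simp add: meas_kernel_def)
    have mB: "(\<lambda>y. emeasure (Qs y) B) \<in> borel_measurable \<mu>" using Qs B by (simp add: meas_kernel_def)
    have "kernel_mix \<mu> (indicator B) Q = density \<mu> (\<lambda>y. emeasure (Qs y) B)"
    proof (rule measure_eqI_cont)
      have "emeasure (kernel_mix \<mu> (indicator B) Q) UNIV = (\<integral>\<^sup>+z. indicator B z * emeasure (Q z) UNIV \<partial>\<mu>)"
        using B \<mu> by (subst emeasure_kernel_mix[OF Q']) auto
      also have "\<dots> \<le> (\<integral>\<^sup>+z. 1 \<partial>\<mu>)"
        using prob_space.emeasure_le_1[OF Qp(1)] by (intro nn_integral_mono) (auto split: split_indicator)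
      finally show "emeasure (kernel_mix \<mu> (indicator B) Q) UNIV \<noteq> \<infinity>"
        using \<mu>.emeasure_space_1 by (auto simp: top_unique)
      fix f :: "'z \<Rightarrow> real"
      assume f: "continuous_on UNIV f" "\<And>x. 0 \<le> f x" "\<And>x. f x \<le> 1"
      show "(\<integral>\<^sup>+x. ennreal (f x) \<partial>kernel_mix \<mu> (indicator B) Q) =
            (\<integral>\<^sup>+x. ennreal (f x) \<partial>density \<mu> (\<lambda>y. emeasure (Qs y) B))"
        using 1[OF f iB] by (simp add: nn_dens[OF mB cm[OF f(1)]] eB
            nn_integral_kernel_mix[OF Q' mm[OF iB] cm[OF f(1)]])
    qed (simp_all add: \<mu>)
    then have "(\<integral>\<^sup>+z. a z \<partial>kernel_mix \<mu> (indicator B) Q) = (\<integral>\<^sup>+z. a z \<partial>density \<mu> (\<lambda>y. emeasure (Qs y) B))"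
      by simp
    then show ?thesis
      by (simp add: nn_dens[OF mB a] nn_integral_kernel_mix[OF Q' mm[OF iB] a])
  qed
  have "kernel_mix \<mu> a Qs = density \<mu> (\<lambda>z. \<integral>\<^sup>+y. a y \<partial>Q z)"
  proof (rule measure_eqI)
    fix B assume "B \<in> sets (kernel_mix \<mu> a Qs)"
    then have B: "B \<in> sets borel" by simp
    then show "emeasure (kernel_mix \<mu> a Qs) B = emeasure (density \<mu> (\<lambda>z. \<integral>\<^sup>+y. a y \<partial>Q z)) B"
      using 2[OF B] \<mu> by (simp add: emeasure_kernel_mix[OF Qs mm[OF a] B] emeasure_density mQ[OF a] mult.commute)
  qed (simp add: \<mu>)
  then have "(\<integral>\<^sup>+z. b z \<partial>kernel_mix \<mu> a Qs) = (\<integral>\<^sup>+z. b z \<partial>density \<mu> (\<lambda>z. \<integral>\<^sup>+y. a y \<partial>Q z))" by simp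
  then show ?thesis
    by (simp add: nn_dens[OF mQ[OF a] b] nn_integral_kernel_mix[OF Qs mm[OF a] b])
qed

section \<open>Jump rates along the flow\<close>

text \<open>Error bounds below have the form \<open>\<eta>\<close> times a quantity such as jump
  probability over \<open>t\<close>. That quantity converges, hence is eventually below
  \<open>\<bar>L\<bar> + 1\<close>, and \<open>\<eta>\<close> is scaled accordingly.\<close>

lemma tendsto_0_le_mult:
  fixes g k :: "'a \<Rightarrow> real"
  assumes k: "(k \<longlongrightarrow> L) F" and g: "\<And>\<eta>. 0 < \<eta> \<Longrightarrow> \<forall>\<^sub>F t in F. \<bar>g t\<bar> \<le> \<eta> * k t"
  shows "(g \<longlongrightarrow> 0) F"
proof (rule tendstoI)
  fix e :: real assume e: "0 < e"
  define \<eta> where "\<eta> = e / 2 / (\<bar>L\<bar> + 1)"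
  have \<eta>: "0 < \<eta>" using e by (simp add: \<eta>_def)
  have "\<forall>\<^sub>F t in F. k t < \<bar>L\<bar> + 1" using k by (rule order_tendstoD) auto
  then show "\<forall>\<^sub>F t in F. dist (g t) 0 < e"
    using g[OF \<eta>]
  proof eventually_elim
    case (elim t)
    have "\<eta> * k t \<le> \<eta> * (\<bar>L\<bar> + 1)" using elim \<eta> by (intro mult_left_mono) auto
    also have "\<dots> = e / 2" by (simp add: \<eta>_def field_simps)
    finally show ?case using elim e by simp
  qed
qed

lemma abs_integral_le_AE:
  fixes f g :: "'a \<Rightarrow> real"
  assumes "integrable M f" "integrable M g" "AE x in M. \<bar>f x\<bar> \<le> g x"
  shows "\<bar>\<integral>x. f x \<partial>M\<bar> \<le> (\<integral>x. g x \<partial>M)"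
proof -
  have "\<bar>\<integral>x. f x \<partial>M\<bar> \<le> (\<integral>x. \<bar>f x\<bar> \<partial>M)"
    using integral_norm_bound[of M f] by simp
  also have "\<dots> \<le> (\<integral>x. g x \<partial>M)"
    using assms by (intro integral_mono_AE) auto
  finally show ?thesis .
qed

section \<open>Paths without a jump and with exactly one jump\<close>

lemma pdmp_path_before_first_jump:
  assumes "ennreal t < S 0 \<omega>"
  shows "pdmp_path \<phi> S Y t \<omega> = \<phi> t (Y 0 \<omega>)"
proof -
  have *: "ennreal t < jump_time S (Suc 0) \<omega>" using assms by (simp add: jump_time_def)
  then have "(LEAST n. ennreal t < jump_time S (Suc n) \<omega>) = 0" by (rule Least_eq_0)
  moreover have "\<exists>n. ennreal t < jump_time S (Suc n) \<omega>" using * by blast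
  ultimately show ?thesis unfolding pdmp_path_def by (simp add: jump_time_def Let_def)
qed

lemma pdmp_path_after_first_jump:
  assumes "S 0 \<omega> \<le> ennreal t" "ennreal t < S 0 \<omega> + S 1 \<omega>"
  shows "pdmp_path \<phi> S Y t \<omega> = \<phi> (t - enn2real (S 0 \<omega>)) (Y 1 \<omega>)"
proof -
  have *: "ennreal t < jump_time S (Suc 1) \<omega>" using assms by (simp add: jump_time_def)
  have 0: "\<not> ennreal t < jump_time S (Suc 0) \<omega>" using assms by (simp add: jump_time_def not_less)
  have "(LEAST n. ennreal t < jump_time S (Suc n) \<omega>) = 1"
  proof (rule Least_equality, rule *)
    fix m assume "ennreal t < jump_time S (Suc m) \<omega>"
    then show "1 \<le> m" using 0 by (cases m) auto
  qed
  moreover have "\<exists>n. ennreal t < jump_time S (Suc n) \<omega>" using * by blast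
  ultimately show ?thesis unfolding pdmp_path_def by (simp add: jump_time_def Let_def)
qed

context assumption_W
begin

text \<open>The integrated hazard of the first jump: \<open>exp (- cum_rate t z)\<close> is the
  probability of no jump up to time \<open>t\<close>.\<close>

definition cum_rate :: "real \<Rightarrow> 'z \<Rightarrow> real" where
  "cum_rate t z = (LBINT s:{0..t}. lam (\<phi> s z))"

lemma lam_nonneg: "0 \<le> lam z"
  using lr_nonneg lb_nonneg by (simp add: lam_eq)

lemma lam_cont: "continuous_on UNIV lam"
proof -
  have "lam = (\<lambda>z. lr z + lb z)" using lam_eq by auto
  then show ?thesis using W8(1,2) by (auto intro!: continuous_intros)
qed

lemma flow_cont: "continuous_on {0..} (\<lambda>s. \<phi> s z)"
  by (rule continuous_on_vector_derivative) (use flow_deriv in auto)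

lemma flow_comp_cont:
  assumes "continuous_on UNIV f" shows "continuous_on {0..} (\<lambda>s. f (\<phi> s z))"
  by (rule continuous_on_compose2[OF assms flow_cont]) auto

lemma flow_comp_tendsto:
  assumes "continuous_on UNIV f" shows "((\<lambda>s. f (\<phi> s z)) \<longlongrightarrow> f z) (at_right 0)"
proof -
  have "((\<lambda>s. f (\<phi> s z)) \<longlongrightarrow> f z) (at 0 within {0..})"
    using flow_comp_cont[OF assms, of z] by (force simp: continuous_on_def flow_0)
  then show ?thesis by (rule tendsto_within_subset) auto
qed

lemma lam_set_integrable: "set_integrable lborel {0..t} (\<lambda>s. lam (\<phi> s z))"
  by (rule borel_integrable_atLeastAtMost') (rule continuous_on_subset[OF flow_comp_cont[OF lam_cont]], auto)

lemma cum_rate_nonneg: "0 \<le> cum_rate t z"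
  unfolding cum_rate_def set_lebesgue_integral_def
  by (intro integral_nonneg_AE) (auto simp: lam_nonneg)

lemma cum_rate_le:
  assumes "0 \<le> t" "\<And>s. 0 \<le> s \<Longrightarrow> s \<le> t \<Longrightarrow> lam (\<phi> s z) \<le> K"
  shows "cum_rate t z \<le> K * t"
proof -
  have "cum_rate t z \<le> (LBINT s:{0..t}. K)"
    unfolding cum_rate_def
    by (rule set_integral_mono[OF lam_set_integrable]) (use assms in \<open>auto simp: set_integrable_def\<close>)
  also have "\<dots> = K * t" using assms(1) by (simp add: set_lebesgue_integral_def)
  finally show ?thesis .
qed

text \<open>By the growth bound W7, with \<open>c\<close> bounded on the compact interval
  \<open>{0..1}\<close>, the flow started within distance \<open>R\<close> of the origin stays in
  one fixed ball up to time \<open>1\<close>. There W5 and W6 bound the rate.\<close>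

lemma cum_rate_uniform:
  assumes "0 \<le> R"
  obtains K where "0 \<le> K" "\<And>t y. 0 \<le> t \<Longrightarrow> t \<le> 1 \<Longrightarrow> norm y \<le> R \<Longrightarrow> cum_rate t y \<le> K * t"
proof -
  obtain c where c: "continuous_on {0..} c" "\<And>t. t \<ge> 0 \<Longrightarrow> 0 < c t"
    "\<And>t z. t \<ge> 0 \<Longrightarrow> norm (\<phi> t z) \<le> c t * (1 + norm z)"
    using W7 by metis
  obtain C where C: "\<And>s. s \<in> {0..1::real} \<Longrightarrow> c s \<le> C"
  proof -
    have "bounded (c ` {0..1})"
      by (intro compact_imp_bounded compact_continuous_image continuous_on_subset[OF c(1)]) auto
    then obtain C where "\<And>x. x \<in> c ` {0..1} \<Longrightarrow> norm x \<le> C" unfolding bounded_iff by blast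
    then have "\<And>s. s \<in> {0..1::real} \<Longrightarrow> c s \<le> C" by fastforce
    then show ?thesis by (rule that)
  qed
  have C0: "0 < C" using c(2)[of 0] C[of 0] by simp
  obtain M where M: "\<And>z. lr z \<le> M" using W6 by blast
  \<comment> \<open>The added \<open>1\<close> turns a non-strict norm bound into membership of an
    open ball, as W5 requires.\<close>
  define R' where "R' = C * (1 + R) + 1"
  have R': "0 < R'" using C0 assms by (simp add: R'_def add_nonneg_pos)
  obtain L where L: "\<And>z. z \<in> ball 0 R' \<Longrightarrow> lb z \<le> L"
    using W5[OF R'] unfolding bdd_above_def by (metis image_eqI)
  have "cum_rate t y \<le> (M + L) * t" if t: "0 \<le> t" "t \<le> 1" "norm y \<le> R" for t y
  proof (rule cum_rate_le[OF t(1)])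
    fix s :: real assume s: "0 \<le> s" "s \<le> t"
    have "norm (\<phi> s y) \<le> c s * (1 + norm y)" by (rule c(3)[OF s(1)])
    also have "\<dots> \<le> C * (1 + R)"
      using C[of s] s t C0 by (intro mult_mono) auto
    finally have "\<phi> s y \<in> ball 0 R'" by (simp add: R'_def)
    then show "lam (\<phi> s y) \<le> M + L" using M L by (simp add: lam_eq add_mono)
  qed
  moreover have "0 \<le> M + L" using M[of 0] L[of 0] lr_nonneg[of 0] lb_nonneg[of 0] R' by fastforce
  ultimately show ?thesis using that by blast
qed

text \<open>The rate is continuous along the flow, so the integrated hazard has derivative
  \<open>lam z\<close> at \<open>0\<close>, and the chain rule applies to
  \<open>1 - exp (- x)\<close>.\<close>

lemma jump_prob_rate: "((\<lambda>t. (1 - exp (- cum_rate t z)) / t) \<longlongrightarrow> lam z) (at_right 0)"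
proof -
  have cont: "continuous_on {0..1} (\<lambda>s. lam (\<phi> s z))"
    by (rule continuous_on_subset[OF flow_comp_cont[OF lam_cont]]) auto
  have eq: "cum_rate t z = integral {0..t} (\<lambda>s. lam (\<phi> s z))" for t
    unfolding cum_rate_def by (rule set_borel_integral_eq_integral(2)[OF lam_set_integrable])
  have d: "((\<lambda>t. cum_rate t z) has_real_derivative lam z) (at 0 within {0..1})"
    using integral_has_real_derivative[OF cont, of 0] by (simp add: eq flow_0)
  have z: "cum_rate 0 z = 0" by (simp add: eq)
  have "((\<lambda>t. 1 - exp (- cum_rate t z)) has_real_derivative lam z) (at 0 within {0..1})"
    by (rule derivative_eq_intros refl d)+ (simp add: z)
  then show ?thesis
    by (simp add: has_field_derivative_iff z at_within_Icc_at_right)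
qed

lemma cum_rate_tendsto: "((\<lambda>t. exp (- cum_rate t z)) \<longlongrightarrow> 1) (at_right 0)"
proof -
  have "((\<lambda>t. 1 - t * ((1 - exp (- cum_rate t z)) / t)) \<longlongrightarrow> 1 - 0 * lam z) (at_right 0)"
    by (intro tendsto_intros jump_prob_rate)
  moreover have "\<forall>\<^sub>F t in at_right (0::real). 1 - t * ((1 - exp (- cum_rate t z)) / t) = exp (- cum_rate t z)"
    using eventually_at_right_less[of 0] by eventually_elim simp
  ultimately show ?thesis using tendsto_cong by fastforce
qed

section \<open>The mixture of refreshment and reflection\<close>

lemma Q_prob: "prob_space (Q z)" "sets (Q z) = sets borel" "space (Q z) = UNIV"
proof -
  have 1: "Q z \<in> space (prob_algebra borel)" using measurable_space[OF Q_kernel, of z] by simp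
  then show "prob_space (Q z)" and 2: "sets (Q z) = sets borel" by (auto simp: space_prob_algebra)
  show "space (Q z) = UNIV" using sets_eq_imp_space_eq[OF 2] by simp
qed

lemma Qr_prob: "prob_space (Qr z)" "sets (Qr z) = sets borel"
  using measurable_space[OF W2(2), of z] by (auto simp: space_prob_algebra)

lemma Qb_prob: "prob_space (Qb z)" "sets (Qb z) = sets borel"
  using measurable_space[OF W2(1), of z] by (auto simp: space_prob_algebra)

text \<open>The mixture identity is given on sets. Induction over nonnegative measurable functions
  extends it, and a shift by the bound \<open>C\<close> then covers functions of either
  sign.\<close>

lemma Q_mixture_integral:
  assumes f: "f \<in> borel_measurable borel" and C: "\<And>x. \<bar>f x\<bar> \<le> C"
  shows "lam z * (\<integral>y. f y \<partial>Q z) = lr z * (\<integral>y. f y \<partial>Qr z) + lb z * (\<integral>y. f y \<partial>Qb z)"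
proof -
  define N where "N = measure_of UNIV (sets borel) (\<lambda>A. ennreal (lr z) * emeasure (Qr z) A + ennreal (lb z) * emeasure (Qb z) A)"
  interpret Q: prob_space "Q z" by (rule Q_prob)
  interpret Qr: prob_space "Qr z" by (rule Qr_prob)
  interpret Qb: prob_space "Qb z" by (rule Qb_prob)
  have int: "integrable (Q z) g" "integrable (Qr z) g" "integrable (Qb z) g"
    if "g \<in> borel_measurable borel" "\<And>x. \<bar>g x\<bar> \<le> D" for g :: "'z \<Rightarrow> real" and D
    using that by (auto intro!: Q.integrable_const_bound[of _ D] Qr.integrable_const_bound[of _ D]
        Qb.integrable_const_bound[of _ D] simp: measurable_cong_sets[OF Q_prob(2) refl]
        measurable_cong_sets[OF Qr_prob(2) refl] measurable_cong_sets[OF Qb_prob(2) refl])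
  have nn: "ennreal (lam z) * (\<integral>\<^sup>+y. g y \<partial>Q z) =
      ennreal (lr z) * (\<integral>\<^sup>+y. g y \<partial>Qr z) + ennreal (lb z) * (\<integral>\<^sup>+y. g y \<partial>Qb z)"
    if "g \<in> borel_measurable borel" for g
    using that
  proof (induction rule: borel_measurable_induct)
    have m: "g \<in> borel_measurable (Q z)" "g \<in> borel_measurable (Qr z)" "g \<in> borel_measurable (Qb z)"
      if "g \<in> borel_measurable borel" for g :: "_ \<Rightarrow> ennreal"
      using that by (simp_all add: measurable_cong_sets[OF Q_prob(2) refl]
        measurable_cong_sets[OF Qr_prob(2) refl] measurable_cong_sets[OF Qb_prob(2) refl])
    {
      case (cong f g)
      then have "f = g" by (intro ext) simp
      then show ?case using cong by simp
    next
      case (set A)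
      have "ennreal (lam z * measure (Q z) A) = ennreal (lr z * measure (Qr z) A + lb z * measure (Qb z) A)"
        using Q_mixture[OF set, of z] by simp
      then show ?case using set lam_nonneg[of z] lr_nonneg[of z] lb_nonneg[of z]
        by (simp add: Q_prob Qr_prob Qb_prob ennreal_mult Q.emeasure_eq_measure
            Qr.emeasure_eq_measure Qb.emeasure_eq_measure)
    next
      case (mult u c)
      have "ennreal (lam z) * (c * (\<integral>\<^sup>+y. u y \<partial>Q z)) = c * (ennreal (lam z) * (\<integral>\<^sup>+y. u y \<partial>Q z))"
        by (simp add: mult.left_commute)
      then show ?case using mult
        by (simp add: nn_integral_cmult m distrib_left mult.left_commute)
    next
      case (add u v)
      then show ?case by (simp add: nn_integral_add m distrib_left ac_simps)
    next
      case (seq U)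
      have s: "(\<integral>\<^sup>+y. (SUP i. U i) y \<partial>L) = (SUP i. \<integral>\<^sup>+y. U i y \<partial>L)"
        if "\<And>i. U i \<in> borel_measurable L" for L
        using seq that by (simp add: SUP_apply image_image nn_integral_monotone_convergence_SUP)
      have inc: "incseq (\<lambda>i. c * (\<integral>\<^sup>+y. U i y \<partial>L))" for c :: ennreal and L
        using \<open>incseq U\<close> by (auto simp: incseq_def le_fun_def intro!: mult_left_mono nn_integral_mono)
      have "ennreal (lam z) * (\<integral>\<^sup>+y. (SUP i. U i) y \<partial>Q z) = (SUP i. ennreal (lam z) * (\<integral>\<^sup>+y. U i y \<partial>Q z))"
        using seq by (subst s) (auto simp: m SUP_mult_left_ennreal)
      also have "\<dots> = (SUP i. ennreal (lr z) * (\<integral>\<^sup>+y. U i y \<partial>Qr z) + ennreal (lb z) * (\<integral>\<^sup>+y. U i y \<partial>Qb z))"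
        using seq by simp
      also have "\<dots> = (SUP i. ennreal (lr z) * (\<integral>\<^sup>+y. U i y \<partial>Qr z)) + (SUP i. ennreal (lb z) * (\<integral>\<^sup>+y. U i y \<partial>Qb z))"
        by (rule ennreal_SUP_add[OF inc inc])
      also have "\<dots> = ennreal (lr z) * (\<integral>\<^sup>+y. (SUP i. U i) y \<partial>Qr z) + ennreal (lb z) * (\<integral>\<^sup>+y. (SUP i. U i) y \<partial>Qb z)"
        using seq by (subst (1 2) s) (auto simp: m SUP_mult_left_ennreal)
      finally show ?case .
    }
  qed
  \<comment> \<open>The shift drops out in the end: all three kernels have mass \<open>1\<close>,
    and \<open>lam z = lr z + lb z\<close>.\<close>
  define v where "v = (\<lambda>x. f x + C)"
  have v0: "0 \<le> v x" for x using C[of x] by (simp add: v_def)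
  have vC: "\<bar>v x\<bar> \<le> 2 * C" for x using C[of x] by (simp add: v_def)
  have vm: "v \<in> borel_measurable borel" using f by (simp add: v_def)
  have iv: "(\<integral>\<^sup>+y. ennreal (v y) \<partial>Q z) = ennreal (\<integral>y. v y \<partial>Q z)"
    "(\<integral>\<^sup>+y. ennreal (v y) \<partial>Qr z) = ennreal (\<integral>y. v y \<partial>Qr z)"
    "(\<integral>\<^sup>+y. ennreal (v y) \<partial>Qb z) = ennreal (\<integral>y. v y \<partial>Qb z)"
    using int[OF vm vC] v0 by (simp_all add: nn_integral_eq_integral)
  have "ennreal (lam z * (\<integral>y. v y \<partial>Q z)) = ennreal (lr z * (\<integral>y. v y \<partial>Qr z) + lb z * (\<integral>y. v y \<partial>Qb z))"
    using nn[of "\<lambda>x. ennreal (v x)"] vm lam_nonneg[of z] lr_nonneg[of z] lb_nonneg[of z] v0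
    by (simp add: iv ennreal_mult)
  then have "lam z * (\<integral>y. v y \<partial>Q z) = lr z * (\<integral>y. v y \<partial>Qr z) + lb z * (\<integral>y. v y \<partial>Qb z)"
    using lam_nonneg[of z] lr_nonneg[of z] lb_nonneg[of z] v0 by (subst (asm) ennreal_inj) auto
  moreover have "(\<integral>y. v y \<partial>Q z) = (\<integral>y. f y \<partial>Q z) + C" "(\<integral>y. v y \<partial>Qr z) = (\<integral>y. f y \<partial>Qr z) + C"
    "(\<integral>y. v y \<partial>Qb z) = (\<integral>y. f y \<partial>Qb z) + C"
    using int[OF f C] by (simp_all add: v_def Q.prob_space Qr.prob_space Qb.prob_space)
  ultimately show ?thesis by (simp add: lam_eq algebra_simps)
qed

text \<open>W8 concerns \<open>Qr\<close> and \<open>Qb\<close> separately. Dividing by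
  \<open>lam\<close> is impossible where it vanishes, and there \<open>Q\<close> may be
  discontinuous; hence the product is the right object.\<close>

lemma lam_Q_cont:
  fixes f :: "'z \<Rightarrow> real"
  assumes f: "f \<in> bcontfun"
  shows "continuous_on UNIV (\<lambda>z. lam z * (\<integral>y. f y \<partial>Q z))"
proof -
  have c: "continuous_on UNIV f" using f by (simp add: bcontfun_def)
  obtain C where "\<And>x. \<bar>f x\<bar> \<le> C"
    using f by (auto simp: bcontfun_def bounded_iff)
  then have "(\<lambda>z. lam z * (\<integral>y. f y \<partial>Q z)) = (\<lambda>z. lr z * (\<integral>y. f y \<partial>Qr z) + lb z * (\<integral>y. f y \<partial>Qb z))"
    using Q_mixture_integral[OF borel_measurable_continuous_onI[OF c]] by blast
  then show ?thesis using W8(1,2) W8(3,4)[OF f] by (simp only:) (intro continuous_intros)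
qed

lemma Q_integrable:
  fixes g :: "'z \<Rightarrow> real"
  assumes "g \<in> borel_measurable borel" "\<And>x. \<bar>g x\<bar> \<le> C"
  shows "integrable (Q z) g"
proof -
  interpret Q: prob_space "Q z" by (rule Q_prob)
  show ?thesis using assms
    by (intro Q.integrable_const_bound[of _ C]) (auto simp: measurable_cong_sets[OF Q_prob(2) refl])
qed

lemma Q_integral_abs_le:
  fixes g :: "'z \<Rightarrow> real"
  assumes "g \<in> borel_measurable borel" "\<And>x. \<bar>g x\<bar> \<le> C"
  shows "\<bar>\<integral>y. g y \<partial>Q z\<bar> \<le> C"
proof -
  interpret Q: prob_space "Q z" by (rule Q_prob)
  have "\<bar>\<integral>y. g y \<partial>Q z\<bar> \<le> (\<integral>y. C \<partial>Q z)"
    by (rule abs_integral_le_AE[OF Q_integrable[OF assms]]) (use assms in auto)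
  then show ?thesis by (simp add: Q.prob_space)
qed

lemma Q_nn_integral:
  fixes g :: "'z \<Rightarrow> real"
  assumes "g \<in> borel_measurable borel" "\<And>x. \<bar>g x\<bar> \<le> C" "\<And>x. 0 \<le> g x"
  shows "(\<integral>\<^sup>+y. ennreal (g y) \<partial>Q z) = ennreal (\<integral>y. g y \<partial>Q z)"
  using Q_integrable[OF assms(1,2)] assms(3) by (intro nn_integral_eq_integral) auto

lemma Q_integral_add_const:
  fixes g :: "'z \<Rightarrow> real"
  assumes "g \<in> borel_measurable borel" "\<And>x. \<bar>g x\<bar> \<le> C"
  shows "(\<integral>y. g y + c \<partial>Q z) = (\<integral>y. g y \<partial>Q z) + c"
proof -
  interpret Q: prob_space "Q z" by (rule Q_prob)
  show ?thesis using Q_integrable[OF assms] by (simp add: Q.prob_space)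
qed

lemma Q_integral_measurable:
  fixes g :: "'z \<Rightarrow> real"
  assumes g: "g \<in> borel_measurable borel" and C: "\<And>x. \<bar>g x\<bar> \<le> C"
  shows "(\<lambda>z. \<integral>y. g y \<partial>Q z) \<in> borel_measurable borel"
proof -
  define v where "v = (\<lambda>x. g x + C)"
  have v: "v \<in> borel_measurable borel" "\<bar>v x\<bar> \<le> 2 * C" "0 \<le> v x" for x
    using g C[of x] by (auto simp: v_def)
  have k: "meas_kernel borel Q" by (rule meas_kernel_prob_algebra[OF Q_kernel]) (simp only: space_borel UNIV_I)
  have "(\<lambda>z. enn2real (\<integral>\<^sup>+y. ennreal (v y) \<partial>Q z)) \<in> borel_measurable borel"
    using v(1) by (intro borel_measurable_enn2real nn_integral_kernel_measurable[OF k]) auto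
  moreover have "enn2real (\<integral>\<^sup>+y. ennreal (v y) \<partial>Q z) = (\<integral>y. g y \<partial>Q z) + C" for z
  proof -
    have "enn2real (\<integral>\<^sup>+y. ennreal (v y) \<partial>Q z) = (\<integral>y. v y \<partial>Q z)"
      using v(3) by (simp add: Q_nn_integral[OF v])
    then show ?thesis by (simp only: v_def Q_integral_add_const[OF g C])
  qed
  ultimately have "(\<lambda>z. (\<integral>y. g y \<partial>Q z) + C - C) \<in> borel_measurable borel"
    by (intro borel_measurable_diff borel_measurable_const) simp
  then show ?thesis by simp
qed

end

section \<open>The first two jumps\<close>

lemma subalgebra_jump_history:
  fixes Y :: "nat \<Rightarrow> 'w \<Rightarrow> 'z::topological_space" and S :: "nat \<Rightarrow> 'w \<Rightarrow> ennreal"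
  assumes "\<And>n. Y n \<in> borel_measurable M" "\<And>n. S n \<in> borel_measurable M"
  shows "subalgebra M (jump_history M S Y n k)"
proof -
  let ?g = "\<lambda>\<omega>. (\<lambda>i\<in>{..n}. Y i \<omega>, \<lambda>i\<in>{..<k}. S i \<omega>)"
  let ?N = "(\<Pi>\<^sub>M i\<in>{..n}. (borel :: 'z measure)) \<Otimes>\<^sub>M (\<Pi>\<^sub>M i\<in>{..<k}. (borel :: ennreal measure))"
  have "?g \<in> M \<rightarrow>\<^sub>M ?N"
    by (intro measurable_Pair measurable_restrict assms)
  then show ?thesis
    unfolding subalgebra_def jump_history_def
    by (subst sets_vimage_algebra2) (auto dest: measurable_space intro: measurable_sets)
qed

lemma measurable_jump_history_Y:
  fixes Y :: "nat \<Rightarrow> 'w \<Rightarrow> 'z::topological_space" and S :: "nat \<Rightarrow> 'w \<Rightarrow> ennreal"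
  assumes "i \<le> n"
  shows "Y i \<in> borel_measurable (jump_history M S Y n k)"
proof -
  let ?N = "(\<Pi>\<^sub>M i\<in>{..n}. (borel :: 'z measure)) \<Otimes>\<^sub>M (\<Pi>\<^sub>M i\<in>{..<k}. (borel :: ennreal measure))"
  have "(\<lambda>\<omega>. (\<lambda>i\<in>{..n}. Y i \<omega>, \<lambda>i\<in>{..<k}. S i \<omega>)) \<in> jump_history M S Y n k \<rightarrow>\<^sub>M ?N"
    unfolding jump_history_def by (rule measurable_vimage_algebra1) (auto simp: space_pair_measure space_PiM)
  moreover have "(\<lambda>p. fst p i) \<in> ?N \<rightarrow>\<^sub>M borel"
    using assms by (intro measurable_compose[OF measurable_fst measurable_component_singleton]) auto
  ultimately have "(\<lambda>\<omega>. fst (\<lambda>i\<in>{..n}. Y i \<omega>, \<lambda>i\<in>{..<k}. S i \<omega>) i) \<in> borel_measurable (jump_history M S Y n k)"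
    by (rule measurable_compose)
  then show ?thesis using assms by simp
qed

lemma measurable_jump_history_S:
  fixes Y :: "nat \<Rightarrow> 'w \<Rightarrow> 'z::topological_space" and S :: "nat \<Rightarrow> 'w \<Rightarrow> ennreal"
  assumes "i < k"
  shows "S i \<in> borel_measurable (jump_history M S Y n k)"
proof -
  let ?N = "(\<Pi>\<^sub>M i\<in>{..n}. (borel :: 'z measure)) \<Otimes>\<^sub>M (\<Pi>\<^sub>M i\<in>{..<k}. (borel :: ennreal measure))"
  have "(\<lambda>\<omega>. (\<lambda>i\<in>{..n}. Y i \<omega>, \<lambda>i\<in>{..<k}. S i \<omega>)) \<in> jump_history M S Y n k \<rightarrow>\<^sub>M ?N"
    unfolding jump_history_def by (rule measurable_vimage_algebra1) (auto simp: space_pair_measure space_PiM)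
  moreover have "(\<lambda>p. snd p i) \<in> ?N \<rightarrow>\<^sub>M borel"
    using assms by (intro measurable_compose[OF measurable_snd measurable_component_singleton]) auto
  ultimately have "(\<lambda>\<omega>. snd (\<lambda>i\<in>{..n}. Y i \<omega>, \<lambda>i\<in>{..<k}. S i \<omega>) i) \<in> borel_measurable (jump_history M S Y n k)"
    by (rule measurable_compose)
  then show ?thesis using assms by simp
qed

lemma space_jump_history [simp]: "space (jump_history M S Y n k) = space M"
  by (simp add: jump_history_def)

locale pdmp_W = assumption_W X \<phi> lr lb lam Qr Qb Q + pdmp_process \<phi> lam Q P S Y
  for X :: "'z::banach \<Rightarrow> 'z"
    and \<phi> :: "real \<Rightarrow> 'z \<Rightarrow> 'z"
    and lr lb lam :: "'z \<Rightarrow> real"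
    and Qr Qb Q :: "'z \<Rightarrow> 'z measure"
    and P :: "'z \<Rightarrow> 'w measure"
    and S :: "nat \<Rightarrow> 'w \<Rightarrow> ennreal"
    and Y :: "nat \<Rightarrow> 'w \<Rightarrow> 'z"
begin

lemma subalg_history: "subalgebra (P z) (jump_history (P z) S Y n k)"
  by (intro subalgebra_jump_history Y_measurable S_measurable)

abbreviation T :: "real \<Rightarrow> ('z \<Rightarrow> real) \<Rightarrow> 'z \<Rightarrow> real" where
  "T \<equiv> pdmp_semigroup \<phi> P S Y"

definition jumped :: "'z \<Rightarrow> real \<Rightarrow> 'w set" where
  "jumped z t = {\<omega> \<in> space (P z). S 0 \<omega> \<le> ennreal t}"

text \<open>The dynamics are prescribed as conditional probabilities of events; this is the form in
  which they are integrated over an event \<open>H\<close> of the past.\<close>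

lemma cond_exp_event:
  assumes A: "A \<in> sets (P z)" and H: "H \<in> sets (jump_history (P z) S Y n k)"
  shows "integrable (P z) (\<lambda>\<omega>. indicator H \<omega> * real_cond_exp (P z) (jump_history (P z) S Y n k) (indicator A) \<omega>)"
    and "measure (P z) (H \<inter> A) =
      (\<integral>\<omega>. indicator H \<omega> * real_cond_exp (P z) (jump_history (P z) S Y n k) (indicator A) \<omega> \<partial>P z)"
proof -
  interpret prob_space "P z" by (rule prob_P)
  interpret finite_measure_subalgebra "P z" "jump_history (P z) S Y n k"
    by unfold_locales (rule subalg_history)
  have HP: "H \<in> sets (P z)" using H subalg by (auto simp: subalgebra_def)
  have iA: "integrable (P z) (indicator A :: _ \<Rightarrow> real)" using A by (simp add: emeasure_eq_measure)
  show "integrable (P z) (\<lambda>\<omega>. indicator H \<omega> * real_cond_exp (P z) (jump_history (P z) S Y n k) (indicator A) \<omega>)"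
    using integrable_mult_indicator[OF HP real_cond_exp_int(1)[OF iA]] by simp
  have "measure (P z) (H \<inter> A) = (\<integral>\<omega>\<in>H. indicator A \<omega> \<partial>P z)"
    using HP A by (simp add: set_lebesgue_integral_def indicator_inter_arith[symmetric])
  also have "\<dots> = (\<integral>\<omega>\<in>H. real_cond_exp (P z) (jump_history (P z) S Y n k) (indicator A) \<omega> \<partial>P z)"
    by (rule real_cond_exp_intA[OF iA H])
  finally show "measure (P z) (H \<inter> A) =
      (\<integral>\<omega>. indicator H \<omega> * real_cond_exp (P z) (jump_history (P z) S Y n k) (indicator A) \<omega> \<partial>P z)"
    by (simp add: set_lebesgue_integral_def)
qed

lemma jumped_history: "jumped z t \<in> sets (jump_history (P z) S Y n (Suc k))"
proof -
  have "{\<omega> \<in> space (jump_history (P z) S Y n (Suc k)). S 0 \<omega> \<le> ennreal t} \<in> sets (jump_history (P z) S Y n (Suc k))"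
    by (intro borel_measurable_le measurable_jump_history_S) auto
  then show ?thesis by (simp add: jumped_def)
qed

lemma jumped_sets: "jumped z t \<in> sets (P z)"
  using jumped_history[of z t 0 0] subalg_history[of z 0 1] by (auto simp: subalgebra_def)

lemma no_jump_prob:
  assumes "0 \<le> t"
  shows "measure (P z) {\<omega> \<in> space (P z). ennreal t < S 0 \<omega>} = exp (- cum_rate t z)"
proof -
  interpret prob_space "P z" by (rule prob_P)
  let ?A = "{\<omega> \<in> space (P z). ennreal t < S 0 \<omega>}"
  have A: "?A \<in> sets (P z)" using S_measurable by measurable
  have H: "space (P z) \<in> sets (jump_history (P z) S Y 0 0)"
    using sets.top[of "jump_history (P z) S Y 0 0"] by simp
  have "measure (P z) ?A = measure (P z) (space (P z) \<inter> ?A)" by (simp add: Int_absorb1 subset_eq)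
  also have "\<dots> = (\<integral>\<omega>. indicator (space (P z)) \<omega> * real_cond_exp (P z) (jump_history (P z) S Y 0 0) (indicator ?A) \<omega> \<partial>P z)"
    by (rule cond_exp_event(2)[OF A H])
  \<comment> \<open>Almost surely \<open>Y 0 \<omega> = z\<close>, so the conditional probability is
    a constant.\<close>
  also have "\<dots> = (\<integral>\<omega>. exp (- cum_rate t z) \<partial>P z)"
  proof (rule integral_cong_AE)
    show "AE \<omega> in P z. indicator (space (P z)) \<omega> * real_cond_exp (P z) (jump_history (P z) S Y 0 0) (indicator ?A) \<omega> = exp (- cum_rate t z)"
      using holding_time[OF assms, of z 0] start[of z] AE_space by eventually_elim (simp add: cum_rate_def)
  qed (use cond_exp_event(1)[OF A H] in auto)
  finally show ?thesis by (simp add: prob_space)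
qed

lemma jumped_prob:
  assumes "0 \<le> t"
  shows "measure (P z) (jumped z t) = 1 - exp (- cum_rate t z)"
proof -
  interpret prob_space "P z" by (rule prob_P)
  have "{\<omega> \<in> space (P z). ennreal t < S 0 \<omega>} = space (P z) - jumped z t"
    by (auto simp: jumped_def)
  then show ?thesis using no_jump_prob[OF assms, of z] prob_compl[OF jumped_sets[of z t]] by simp
qed

text \<open>Only a bound is stated because \<open>cum_rate t\<close> is not known to be measurable, so that the
  integral of \<open>exp (- cum_rate t (Y 1 \<omega>))\<close> could be a junk value.\<close>

lemma second_jump_prob:
  assumes t: "0 \<le> t" and B: "B \<in> sets borel" and K0: "0 \<le> K" and K: "\<And>y. y \<in> B \<Longrightarrow> cum_rate t y \<le> K"
  shows "measure (P z) {\<omega> \<in> jumped z t. Y 1 \<omega> \<in> B \<and> S 1 \<omega> \<le> ennreal t} \<le> K * measure (P z) (jumped z t)"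
proof -
  interpret prob_space "P z" by (rule prob_P)
  let ?J = "jump_history (P z) S Y 1 1"
  let ?A = "{\<omega> \<in> space (P z). ennreal t < S 1 \<omega>}"
  \<comment> \<open>Indices \<open>1 1\<close> of the history mean \<open>Y 0\<close>,
    \<open>Y 1\<close> and \<open>S 0\<close>: all that is known at the first jump, so
    \<open>H\<close> belongs to it.\<close>
  define H where "H = jumped z t \<inter> {\<omega> \<in> space (P z). Y 1 \<omega> \<in> B}"
  have A: "?A \<in> sets (P z)" using S_measurable by measurable
  have "{\<omega> \<in> space ?J. Y 1 \<omega> \<in> B} \<in> sets ?J"
    using measurable_sets[OF measurable_jump_history_Y[of 1 1 Y "P z" S 1] B]
    by (simp add: vimage_def Int_def conj_commute)
  then have H: "H \<in> sets ?J" using jumped_history[of z t 1 0] by (auto simp: H_def)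
  have HP: "H \<in> sets (P z)" using H subalg_history[of z 1 1] by (auto simp: subalgebra_def)
  \<comment> \<open>The inequality \<open>1 - x \<le> exp (- x)\<close> puts the constant
    \<open>1 - K\<close> in place of the conditional probability, which gives a lower bound for
    having no jump; the claim follows by taking complements inside \<open>H\<close>.\<close>
  have "(1 - K) * measure (P z) H = (\<integral>\<omega>. indicator H \<omega> * (1 - K) \<partial>P z)"
    using HP by (simp add: mult.commute)
  also have "\<dots> \<le> (\<integral>\<omega>. indicator H \<omega> * real_cond_exp (P z) ?J (indicator ?A) \<omega> \<partial>P z)"
  proof (rule integral_mono_AE)
    show "integrable (P z) (\<lambda>\<omega>. indicator H \<omega> * (1 - K))"
      using HP by (simp add: emeasure_eq_measure)
    show "integrable (P z) (\<lambda>\<omega>. indicator H \<omega> * real_cond_exp (P z) ?J (indicator ?A) \<omega>)"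
      by (rule cond_exp_event(1)[OF A H])
    show "AE \<omega> in P z. indicator H \<omega> * (1 - K) \<le> indicator H \<omega> * real_cond_exp (P z) ?J (indicator ?A) \<omega>"
      using holding_time[OF t, of z 1]
    proof eventually_elim
      case (elim \<omega>)
      have "1 - K \<le> exp (- cum_rate t (Y 1 \<omega>))" if "\<omega> \<in> H"
        using K[of "Y 1 \<omega>"] that exp_ge_add_one_self[of "- cum_rate t (Y 1 \<omega>)"] by (auto simp: H_def)
      then show ?case using elim by (auto simp: cum_rate_def split: split_indicator)
    qed
  qed
  also have "\<dots> = measure (P z) (H \<inter> ?A)" by (rule cond_exp_event(2)[OF A H, symmetric])
  finally have 1: "(1 - K) * measure (P z) H \<le> measure (P z) (H \<inter> ?A)" .
  have "{\<omega> \<in> jumped z t. Y 1 \<omega> \<in> B \<and> S 1 \<omega> \<le> ennreal t} = H - H \<inter> ?A"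
    by (auto simp: H_def jumped_def)
  then have "measure (P z) {\<omega> \<in> jumped z t. Y 1 \<omega> \<in> B \<and> S 1 \<omega> \<le> ennreal t} = measure (P z) H - measure (P z) (H \<inter> ?A)"
    using HP A by (simp add: finite_measure_Diff)
  also have "\<dots> \<le> K * measure (P z) H" using 1 by (simp add: algebra_simps)
  also have "\<dots> \<le> K * measure (P z) (jumped z t)"
    by (intro mult_left_mono K0 finite_measure_mono jumped_sets) (auto simp: H_def)
  finally show ?thesis .
qed

lemma flow_S_measurable: "(\<lambda>\<omega>. \<phi> (enn2real (S 0 \<omega>)) z) \<in> borel_measurable (P z)"
proof -
  \<comment> \<open>The flow is constrained at nonnegative times only. Precomposition with
    \<open>max 0\<close> gives a globally continuous function that agrees with it on values of
    \<open>enn2real\<close>.\<close>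
  have "continuous_on UNIV (\<lambda>s. \<phi> (max 0 s) z)"
    by (rule continuous_on_compose2[OF flow_cont]) (auto intro!: continuous_intros)
  then have "(\<lambda>s. \<phi> (max 0 s) z) \<in> borel_measurable borel" by (rule borel_measurable_continuous_onI)
  then have "(\<lambda>\<omega>. \<phi> (max 0 (enn2real (S 0 \<omega>))) z) \<in> borel_measurable (P z)"
    by (rule measurable_compose[rotated]) (use S_measurable in measurable)
  then show ?thesis by simp
qed

lemma Q_flow_kernel:
  "meas_kernel (P z) (\<lambda>\<omega>. Q (\<phi> (enn2real (S 0 \<omega>)) z))"
proof -
  have "meas_kernel borel Q" by (rule meas_kernel_prob_algebra[OF Q_kernel]) (simp only: space_borel UNIV_I)
  then have "\<And>B. B \<in> sets borel \<Longrightarrow> (\<lambda>y. emeasure (Q y) B) \<in> borel_measurable borel"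
    by (simp add: meas_kernel_def)
  then show ?thesis
    unfolding meas_kernel_def by (intro conjI allI ballI Q_prob(2)) (rule measurable_compose[OF flow_S_measurable])
qed

text \<open>Both sides integrate \<open>g\<close> against a measure on the state space: the law of
  \<open>Y 1\<close> restricted to \<open>jumped z t\<close>, and the mixture of the kernels met at
  the first jump. The post-jump condition makes them agree on Borel sets.\<close>

lemma first_jump_state_nn:
  assumes g: "g \<in> borel_measurable borel"
  shows "(\<integral>\<^sup>+\<omega>. indicator (jumped z t) \<omega> * g (Y 1 \<omega>) \<partial>P z) =
    (\<integral>\<^sup>+\<omega>. indicator (jumped z t) \<omega> * (\<integral>\<^sup>+y. g y \<partial>Q (\<phi> (enn2real (S 0 \<omega>)) z)) \<partial>P z)"
proof -
  interpret prob_space "P z" by (rule prob_P)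
  let ?H = "jumped z t" and ?K = "\<lambda>\<omega>. Q (\<phi> (enn2real (S 0 \<omega>)) z)" and ?J = "jump_history (P z) S Y 0 1"
  have Hm: "indicator ?H \<in> borel_measurable (P z)" using jumped_sets by simp
  have eq: "kernel_mix (P z) (indicator ?H) ?K = distr (density (P z) (indicator ?H)) borel (Y 1)"
  proof (rule measure_eqI)
    fix A assume "A \<in> sets (kernel_mix (P z) (indicator ?H) ?K)"
    then have A: "A \<in> sets borel" by simp
    let ?A = "{\<omega> \<in> space (P z). Y 1 \<omega> \<in> A}"
    have YA: "?A \<in> sets (P z)" using Y_measurable A by measurable
    have H: "?H \<in> sets ?J" using jumped_history[of z t 0 0] by simp
    have Km: "(\<lambda>\<omega>. measure (?K \<omega>) A) \<in> borel_measurable (P z)"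
      using Q_flow_kernel[of z] A unfolding meas_kernel_def measure_def
      by (intro borel_measurable_enn2real) auto
    have em: "emeasure (?K \<omega>) A = ennreal (measure (?K \<omega>) A)" for \<omega>
      using Q_prob(1) by (simp add: finite_measure.emeasure_eq_measure prob_space.finite_measure)
    have "measure (P z) (?H \<inter> ?A) = (\<integral>\<omega>. indicator ?H \<omega> * real_cond_exp (P z) ?J (indicator ?A) \<omega> \<partial>P z)"
      by (rule cond_exp_event(2)[OF YA H])
    also have "\<dots> = (\<integral>\<omega>. indicator ?H \<omega> * measure (?K \<omega>) A \<partial>P z)"
    proof (rule integral_cong_AE)
      show "AE \<omega> in P z. indicator ?H \<omega> * real_cond_exp (P z) ?J (indicator ?A) \<omega> = indicator ?H \<omega> * measure (?K \<omega>) A"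
        using post_jump[OF A, where z = z and n = 0] start[of z]
      proof eventually_elim
        case (elim \<omega>)
        \<comment> \<open>The post-jump law is prescribed only after finite holding times.\<close>
        have "S 0 \<omega> < \<infinity>" if "\<omega> \<in> ?H"
          using that by (auto simp: jumped_def intro: le_less_trans)
        then show ?case using elim by (auto split: split_indicator)
      qed
    qed (use cond_exp_event(1)[OF YA H] Hm Km jumped_sets in auto)
    finally have 1: "measure (P z) (?H \<inter> ?A) = (\<integral>\<omega>. indicator ?H \<omega> * measure (?K \<omega>) A \<partial>P z)" .
    have "emeasure (kernel_mix (P z) (indicator ?H) ?K) A = (\<integral>\<^sup>+\<omega>. ennreal (indicator ?H \<omega> * measure (?K \<omega>) A) \<partial>P z)"
      by (simp add: emeasure_kernel_mix[OF Q_flow_kernel Hm A] em ennreal_mult' ennreal_indicator)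
    also have "\<dots> = ennreal (\<integral>\<omega>. indicator ?H \<omega> * measure (?K \<omega>) A \<partial>P z)"
    proof (rule nn_integral_eq_integral)
      show "integrable (P z) (\<lambda>\<omega>. indicator ?H \<omega> * measure (?K \<omega>) A)"
        using Km jumped_sets prob_space.prob_le_1[OF Q_prob(1)]
        by (intro integrable_const_bound[of _ 1]) (auto split: split_indicator)
    qed simp
    also have "\<dots> = emeasure (P z) (?H \<inter> ?A)" using 1 by (simp add: emeasure_eq_measure)
    also have "\<dots> = emeasure (density (P z) (indicator ?H)) ?A"
      using YA jumped_sets by (simp add: emeasure_density indicator_inter_arith[symmetric])
    also have "\<dots> = emeasure (distr (density (P z) (indicator ?H)) borel (Y 1)) A"
      using A Y_measurable by (subst emeasure_distr) (auto simp: vimage_def Int_def conj_commute)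
    finally show "emeasure (kernel_mix (P z) (indicator ?H) ?K) A = emeasure (distr (density (P z) (indicator ?H)) borel (Y 1)) A" .
  qed simp
  have gY: "(\<lambda>\<omega>. g (Y 1 \<omega>)) \<in> borel_measurable (P z)" by (rule measurable_compose[OF Y_measurable g])
  have "(\<integral>\<^sup>+\<omega>. indicator ?H \<omega> * g (Y 1 \<omega>) \<partial>P z) = (\<integral>\<^sup>+y. g y \<partial>distr (density (P z) (indicator ?H)) borel (Y 1))"
    using Y_measurable g by (subst nn_integral_distr) (auto simp: nn_integral_density[OF Hm] gY[simplified])
  also have "\<dots> = (\<integral>\<^sup>+\<omega>. indicator ?H \<omega> * (\<integral>\<^sup>+y. g y \<partial>?K \<omega>) \<partial>P z)"
    unfolding eq[symmetric] by (rule nn_integral_kernel_mix[OF Q_flow_kernel Hm g])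
  finally show ?thesis .
qed

end

section \<open>The semigroup for small times\<close>

context pdmp_W
begin

text \<open>The function is evaluated at the state just after the jump, not at time
  \<open>t\<close>; whatever happens in between is treated as an error later.\<close>

definition first_jump_exp :: "'z \<Rightarrow> real \<Rightarrow> ('z \<Rightarrow> real) \<Rightarrow> real" where
  "first_jump_exp z t g = (\<integral>\<omega>. indicator (jumped z t) \<omega> * g (Y 1 \<omega>) \<partial>P z)"

lemma jump_state_integrable:
  fixes g :: "'z \<Rightarrow> real"
  assumes "g \<in> borel_measurable borel" "\<And>x. \<bar>g x\<bar> \<le> C"
  shows "integrable (P z) (\<lambda>\<omega>. indicator (jumped z t) \<omega> * g (Y 1 \<omega>))"
proof -
  interpret prob_space "P z" by (rule prob_P)
  have "(\<lambda>\<omega>. g (Y 1 \<omega>)) \<in> borel_measurable (P z)"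
    by (rule measurable_compose[OF Y_measurable assms(1)])
  moreover have "0 \<le> C" using assms(2)[of undefined] by linarith
  ultimately show ?thesis using jumped_sets assms(2)
    by (intro integrable_const_bound[of _ C]) (auto split: split_indicator)
qed

lemma Q_flow_integrable:
  fixes g :: "'z \<Rightarrow> real"
  assumes g: "g \<in> borel_measurable borel" and C: "\<And>x. \<bar>g x\<bar> \<le> C"
  shows "integrable (P z) (\<lambda>\<omega>. indicator (jumped z t) \<omega> * (\<integral>y. g y \<partial>Q (\<phi> (enn2real (S 0 \<omega>)) z)))"
proof -
  interpret prob_space "P z" by (rule prob_P)
  have "(\<lambda>\<omega>. \<integral>y. g y \<partial>Q (\<phi> (enn2real (S 0 \<omega>)) z)) \<in> borel_measurable (P z)"
    by (rule measurable_compose[OF flow_S_measurable Q_integral_measurable[OF g C]])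
  moreover have "0 \<le> C" using C[of undefined] by linarith
  ultimately show ?thesis using jumped_sets Q_integral_abs_le[OF g C]
    by (intro integrable_const_bound[of _ C]) (auto split: split_indicator)
qed

lemma first_jump_exp_eq:
  fixes g :: "'z \<Rightarrow> real"
  assumes g: "g \<in> borel_measurable borel" and C: "\<And>x. \<bar>g x\<bar> \<le> C"
  shows "first_jump_exp z t g =
    (\<integral>\<omega>. indicator (jumped z t) \<omega> * (\<integral>y. g y \<partial>Q (\<phi> (enn2real (S 0 \<omega>)) z)) \<partial>P z)"
proof -
  interpret prob_space "P z" by (rule prob_P)
  define v where "v = (\<lambda>x. g x + C)"
  have v: "v \<in> borel_measurable borel" "\<bar>v x\<bar> \<le> 2 * C" "0 \<le> v x" for x
    using g C[of x] by (auto simp: v_def)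
  have Qv: "(\<integral>y. v y \<partial>Q x) = (\<integral>y. g y \<partial>Q x) + C" for x
    unfolding v_def by (rule Q_integral_add_const[OF g C])
  let ?J = "indicator (jumped z t) :: 'w \<Rightarrow> real" and ?x = "\<lambda>\<omega>. \<phi> (enn2real (S 0 \<omega>)) z"
  have "ennreal (\<integral>\<omega>. ?J \<omega> * v (Y 1 \<omega>) \<partial>P z) = (\<integral>\<^sup>+\<omega>. ennreal (?J \<omega> * v (Y 1 \<omega>)) \<partial>P z)"
    using v by (intro nn_integral_eq_integral[symmetric] jump_state_integrable[OF v(1,2)]) auto
  also have "\<dots> = (\<integral>\<^sup>+\<omega>. indicator (jumped z t) \<omega> * ennreal (v (Y 1 \<omega>)) \<partial>P z)"
    by (intro nn_integral_cong) (auto split: split_indicator)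
  also have "\<dots> = (\<integral>\<^sup>+\<omega>. indicator (jumped z t) \<omega> * (\<integral>\<^sup>+y. ennreal (v y) \<partial>Q (?x \<omega>)) \<partial>P z)"
    using v by (intro first_jump_state_nn) auto
  also have "\<dots> = (\<integral>\<^sup>+\<omega>. ennreal (?J \<omega> * (\<integral>y. v y \<partial>Q (?x \<omega>))) \<partial>P z)"
    by (intro nn_integral_cong) (auto simp: Q_nn_integral[OF v] split: split_indicator)
  also have "\<dots> = ennreal (\<integral>\<omega>. ?J \<omega> * (\<integral>y. v y \<partial>Q (?x \<omega>)) \<partial>P z)"
    using v by (intro nn_integral_eq_integral Q_flow_integrable[OF v(1,2)]) auto
  finally have "(\<integral>\<omega>. ?J \<omega> * v (Y 1 \<omega>) \<partial>P z) = (\<integral>\<omega>. ?J \<omega> * (\<integral>y. v y \<partial>Q (?x \<omega>)) \<partial>P z)"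
    using v by (subst (asm) ennreal_inj) auto
  moreover have "(\<integral>\<omega>. ?J \<omega> * v (Y 1 \<omega>) \<partial>P z) = first_jump_exp z t g + (\<integral>\<omega>. ?J \<omega> * C \<partial>P z)"
    unfolding first_jump_exp_def v_def distrib_left
    using jumped_sets by (intro Bochner_Integration.integral_add jump_state_integrable[OF g C]) (simp add: emeasure_eq_measure)
  moreover have "(\<integral>\<omega>. ?J \<omega> * (\<integral>y. v y \<partial>Q (?x \<omega>)) \<partial>P z) =
      (\<integral>\<omega>. ?J \<omega> * (\<integral>y. g y \<partial>Q (?x \<omega>)) \<partial>P z) + (\<integral>\<omega>. ?J \<omega> * C \<partial>P z)"
    unfolding Qv distrib_left
    using jumped_sets by (intro Bochner_Integration.integral_add Q_flow_integrable[OF g C]) (simp add: emeasure_eq_measure)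
  ultimately show ?thesis by simp
qed

text \<open>On \<open>jumped z t\<close> the jump starts from \<open>\<phi> s z\<close> for some
  \<open>s \<le> t\<close>, so the oscillation of \<open>Q g\<close> along this piece of the flow
  controls the error. The reference value \<open>q\<close> is left free in order to cover points of
  rate zero.\<close>

lemma first_jump_exp_approx:
  assumes g: "g \<in> borel_measurable borel" and C: "\<And>x. \<bar>g x\<bar> \<le> C" and t: "0 \<le> t"
    and q: "\<And>s. 0 \<le> s \<Longrightarrow> s \<le> t \<Longrightarrow> \<bar>(\<integral>y. g y \<partial>Q (\<phi> s z)) - q\<bar> \<le> \<eta>"
  shows "\<bar>first_jump_exp z t g - q * measure (P z) (jumped z t)\<bar> \<le> \<eta> * measure (P z) (jumped z t)"
proof -
  interpret prob_space "P z" by (rule prob_P)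
  let ?J = "indicator (jumped z t) :: 'w \<Rightarrow> real" and ?G = "\<lambda>\<omega>. \<integral>y. g y \<partial>Q (\<phi> (enn2real (S 0 \<omega>)) z)"
  have iJ: "integrable (P z) (\<lambda>\<omega>. ?J \<omega> * c)" for c
    using jumped_sets by (simp add: emeasure_eq_measure)
  have eq: "first_jump_exp z t g - q * measure (P z) (jumped z t) = (\<integral>\<omega>. ?J \<omega> * ?G \<omega> - ?J \<omega> * q \<partial>P z)"
    using jumped_sets
    by (subst Bochner_Integration.integral_diff[OF Q_flow_integrable[OF g C] iJ]) (simp add: first_jump_exp_eq[OF g C] mult.commute)
  have "\<bar>\<integral>\<omega>. ?J \<omega> * ?G \<omega> - ?J \<omega> * q \<partial>P z\<bar> \<le> (\<integral>\<omega>. ?J \<omega> * \<eta> \<partial>P z)"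
  proof (rule abs_integral_le_AE)
    have "\<bar>?J \<omega> * ?G \<omega> - ?J \<omega> * q\<bar> \<le> ?J \<omega> * \<eta>" for \<omega>
    proof -
      have "enn2real (S 0 \<omega>) \<le> t" if "\<omega> \<in> jumped z t"
        using that t by (auto simp: jumped_def intro: enn2real_leI)
      then show ?thesis
        using q[of "enn2real (S 0 \<omega>)"] by (auto split: split_indicator)
    qed
    then show "AE \<omega> in P z. \<bar>?J \<omega> * ?G \<omega> - ?J \<omega> * q\<bar> \<le> ?J \<omega> * \<eta>" by simp
  qed (intro Bochner_Integration.integrable_diff Q_flow_integrable[OF g C] iJ)+
  then show ?thesis using jumped_sets by (simp add: eq mult.commute)
qed

lemma jumped_rate: "((\<lambda>t. measure (P z) (jumped z t) / t) \<longlongrightarrow> lam z) (at_right 0)"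
proof -
  have "\<forall>\<^sub>F t in at_right 0. (1 - exp (- cum_rate t z)) / t = measure (P z) (jumped z t) / t"
    using eventually_at_right_less[of 0] by eventually_elim (simp add: jumped_prob)
  then show ?thesis by (rule Lim_transform_eventually[OF jump_prob_rate])
qed

text \<open>If \<open>lam z > 0\<close>, then \<open>Q g\<close> is a quotient of continuous
  functions along the flow near \<open>z\<close> and tends to its value at \<open>z\<close>. If
  \<open>lam z = 0\<close>, then \<open>Q g\<close> need not converge, but the jump probability is
  of smaller order than \<open>t\<close> and the crude bound \<open>C\<close> is enough.\<close>

lemma first_jump_exp_rate:
  assumes g: "g \<in> bcontfun"
  shows "((\<lambda>t. first_jump_exp z t g / t) \<longlongrightarrow> lam z * (\<integral>y. g y \<partial>Q z)) (at_right 0)"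
proof -
  have cont: "continuous_on UNIV g" using g by (simp add: bcontfun_def)
  have gm: "g \<in> borel_measurable borel" by (rule borel_measurable_continuous_onI[OF cont])
  obtain C where C: "\<And>x. \<bar>g x\<bar> \<le> C"
    using g by (auto simp: bcontfun_def bounded_iff)
  define p where "p t = measure (P z) (jumped z t)" for t
  \<comment> \<open>With \<open>q = 0\<close> at rate zero, \<open>C\<close> serves as the tolerance
    in \<open>first_jump_exp_approx\<close>.\<close>
  define q where "q = (if lam z = 0 then 0 else (\<integral>y. g y \<partial>Q z))"
  have p: "((\<lambda>t. p t / t) \<longlongrightarrow> lam z) (at_right 0)" unfolding p_def by (rule jumped_rate)
  have "((\<lambda>t. (first_jump_exp z t g - q * p t) / t) \<longlongrightarrow> 0) (at_right 0)"
  proof (cases "lam z = 0")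
    case True
    have "((\<lambda>t. C * (p t / t)) \<longlongrightarrow> C * 0) (at_right 0)"
      using p True by (intro tendsto_intros) simp
    then have lim: "((\<lambda>t. C * (p t / t)) \<longlongrightarrow> 0) (at_right 0)" by simp
    show ?thesis
    proof (rule Lim_null_comparison[OF _ lim])
      show "\<forall>\<^sub>F t in at_right 0. norm ((first_jump_exp z t g - q * p t) / t) \<le> C * (p t / t)"
        using eventually_at_right_less[of 0]
      proof eventually_elim
        case (elim t)
        have "\<bar>first_jump_exp z t g - 0 * p t\<bar> \<le> C * p t"
          unfolding p_def using Q_integral_abs_le[OF gm C] elim
          by (intro first_jump_exp_approx[OF gm C]) auto
        then show ?case using elim True by (simp add: q_def divide_right_mono abs_divide)
      qed
    qed
  next
    case False
    have lpos: "0 < lam z" using lam_nonneg[of z] False by linarith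
    have "((\<lambda>s. (\<lambda>x. lam x * (\<integral>y. g y \<partial>Q x)) (\<phi> s z) / lam (\<phi> s z)) \<longlongrightarrow>
        lam z * (\<integral>y. g y \<partial>Q z) / lam z) (at_right 0)"
      using False by (intro tendsto_divide flow_comp_tendsto lam_Q_cont[OF g] lam_cont)
    moreover have "\<forall>\<^sub>F s in at_right 0. lam (\<phi> s z) * (\<integral>y. g y \<partial>Q (\<phi> s z)) / lam (\<phi> s z) = (\<integral>y. g y \<partial>Q (\<phi> s z))"
      using order_tendstoD(1)[OF flow_comp_tendsto[OF lam_cont, of z] lpos] by eventually_elim simp
    ultimately have Qlim: "((\<lambda>s. \<integral>y. g y \<partial>Q (\<phi> s z)) \<longlongrightarrow> q) (at_right 0)"
      using False tendsto_cong[of "\<lambda>s. lam (\<phi> s z) * (\<integral>y. g y \<partial>Q (\<phi> s z)) / lam (\<phi> s z)"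
          "\<lambda>s. \<integral>y. g y \<partial>Q (\<phi> s z)"] by (auto simp: q_def)
    show ?thesis
    proof (rule tendsto_0_le_mult[OF p])
      fix \<eta> :: real assume \<eta>: "0 < \<eta>"
      have "\<forall>\<^sub>F s in at_right 0. dist (\<integral>y. g y \<partial>Q (\<phi> s z)) q < \<eta>" by (rule tendstoD[OF Qlim \<eta>])
      then obtain b where b: "0 < b" "\<And>s. 0 < s \<Longrightarrow> s < b \<Longrightarrow> dist (\<integral>y. g y \<partial>Q (\<phi> s z)) q < \<eta>"
        unfolding eventually_at_right_field by auto
      \<comment> \<open>The approximation lemma also asks about \<open>s = 0\<close>, which a limit
        from the right does not cover.\<close>
      have q0: "q = (\<integral>y. g y \<partial>Q (\<phi> 0 z))" using False by (simp add: q_def flow_0)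
      show "\<forall>\<^sub>F t in at_right 0. \<bar>(first_jump_exp z t g - q * p t) / t\<bar> \<le> \<eta> * (p t / t)"
        using eventually_at_right_real[OF b(1)]
      proof eventually_elim
        case (elim t)
        have "\<bar>(\<integral>y. g y \<partial>Q (\<phi> s z)) - q\<bar> \<le> \<eta>" if "0 \<le> s" "s \<le> t" for s
          using b(2)[of s] that elim \<eta> q0 by (cases "s = 0") (auto simp: dist_real_def)
        then have "\<bar>first_jump_exp z t g - q * p t\<bar> \<le> \<eta> * p t"
          unfolding p_def using elim by (intro first_jump_exp_approx[OF gm C]) auto
        then show ?case using elim by (simp add: divide_right_mono abs_divide)
      qed
    qed
  qed
  then have "((\<lambda>t. (first_jump_exp z t g - q * p t) / t + q * (p t / t)) \<longlongrightarrow> 0 + q * lam z) (at_right 0)"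
    by (intro tendsto_intros p)
  moreover have "(first_jump_exp z t g - q * p t) / t + q * (p t / t) = first_jump_exp z t g / t" for t
    by (simp add: diff_divide_distrib)
  moreover have "0 + q * lam z = lam z * (\<integral>y. g y \<partial>Q z)" by (simp add: q_def)
  ultimately show ?thesis by (simp only:)
qed

text \<open>The two integrands agree on paths without a jump. On the others the indicator removes
  the second one, which is why the bound has \<open>C\<close> and not \<open>2 * C\<close>.\<close>

lemma semigroup_no_jump:
  assumes f: "continuous_on UNIV f" and C: "\<And>x. \<bar>f x\<bar> \<le> C" and r: "0 \<le> r"
  shows "\<bar>T r f y - exp (- cum_rate r y) * f (\<phi> r y)\<bar> \<le> C * (1 - exp (- cum_rate r y))"
proof -
  interpret prob_space "P y" by (rule prob_P)
  let ?A = "{\<omega> \<in> space (P y). ennreal r < S 0 \<omega>}"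
  have A: "?A \<in> sets (P y)" using S_measurable by measurable
  have "(\<lambda>\<omega>. f (pdmp_path \<phi> S Y r \<omega>)) \<in> borel_measurable (P y)"
    by (rule measurable_compose[OF path_measurable[OF r] borel_measurable_continuous_onI[OF f]])
  then have i1: "integrable (P y) (\<lambda>\<omega>. f (pdmp_path \<phi> S Y r \<omega>))"
    using C by (intro integrable_const_bound[of _ C]) auto
  have i2: "integrable (P y) (\<lambda>\<omega>. indicator ?A \<omega> * f (\<phi> r y))" using A by (simp add: emeasure_eq_measure)
  have "T r f y - exp (- cum_rate r y) * f (\<phi> r y) =
      (\<integral>\<omega>. f (pdmp_path \<phi> S Y r \<omega>) - indicator ?A \<omega> * f (\<phi> r y) \<partial>P y)"
    using A by (subst Bochner_Integration.integral_diff[OF i1 i2]) (simp add: pdmp_semigroup_def no_jump_prob[OF r])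
  also have "\<bar>\<dots>\<bar> \<le> (\<integral>\<omega>. indicator (jumped y r) \<omega> * C \<partial>P y)"
  proof (rule abs_integral_le_AE)
    show "AE \<omega> in P y. \<bar>f (pdmp_path \<phi> S Y r \<omega>) - indicator ?A \<omega> * f (\<phi> r y)\<bar> \<le> indicator (jumped y r) \<omega> * C"
      using start[of y] AE_space
    proof eventually_elim
      case (elim \<omega>)
      show ?case
      proof (cases "ennreal r < S 0 \<omega>")
        case True
        then show ?thesis using elim C[of "\<phi> r y"] by (auto simp: pdmp_path_before_first_jump jumped_def split: split_indicator)
      next
        case False
        then show ?thesis using elim C by (auto simp: jumped_def not_less)
      qed
    qed
  qed (use i1 i2 jumped_sets in \<open>auto simp: emeasure_eq_measure\<close>)
  finally show ?thesis using jumped_sets by (simp add: jumped_prob[OF r] mult.commute)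
qed

text \<open>A path without jumps up to time \<open>r\<close> has probability close to \<open>1\<close>, so uniform smallness of
  \<open>T r f - f\<close> carries over to the flow. The flow itself is not assumed continuous in space.\<close>

lemma flow_increment:
  assumes f: "continuous_on UNIV f" and C: "\<And>x. \<bar>f x\<bar> \<le> C" and r: "0 \<le> r"
    and \<epsilon>: "\<bar>T r f y - f y\<bar> \<le> \<epsilon>"
  shows "\<bar>f (\<phi> r y) - f y\<bar> \<le> \<epsilon> + 2 * C * cum_rate r y"
proof -
  define a where "a = exp (- cum_rate r y)"
  have a: "0 \<le> 1 - a" "1 - a \<le> cum_rate r y"
    using cum_rate_nonneg[of r y] exp_ge_add_one_self[of "- cum_rate r y"] by (auto simp: a_def)
  have C0: "0 \<le> C" using C[of y] by linarith
  \<comment> \<open>The factor \<open>2\<close> arises from two replacements, each at cost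
    \<open>C * (1 - a)\<close>: \<open>T r f y\<close> by \<open>a * f (\<phi> r y)\<close>, then
    \<open>a\<close> by \<open>1\<close>.\<close>
  have "\<bar>a * f (\<phi> r y) - f y\<bar> \<le> \<epsilon> + C * (1 - a)"
    using semigroup_no_jump[OF f C r, of y] \<epsilon> by (simp add: a_def)
  moreover have "\<bar>(1 - a) * f (\<phi> r y)\<bar> \<le> (1 - a) * C"
    using a C by (simp add: abs_mult mult_left_mono)
  ultimately have "\<bar>f (\<phi> r y) - f y\<bar> \<le> \<epsilon> + 2 * C * (1 - a)" by (simp add: algebra_simps abs_if split: if_splits)
  also have "\<dots> \<le> \<epsilon> + 2 * C * cum_rate r y" using a C0 by (simp add: mult_left_mono)
  finally show ?thesis .
qed

text \<open>A continuous majorant of the indicator of \<open>norm y > n + 1\<close>: the limit of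
  \<open>first_jump_exp\<close> is available for bounded continuous functions only.\<close>

definition outside :: "nat \<Rightarrow> 'z \<Rightarrow> real" where
  "outside n y = min 1 (max 0 (norm y - real n))"

lemma outside_bcontfun: "outside n \<in> bcontfun"
  by (rule bcontfun_normI[where b=1]) (auto simp: outside_def[abs_def] intro!: continuous_intros)

lemma outside_bounds: "0 \<le> outside n y" "outside n y \<le> 1"
  by (auto simp: outside_def)

text \<open>A single probability measure is concentrated on large balls. Bounded sets suffice here,
  compact ones are not asked for, because W5 bounds the rate on balls.\<close>

lemma Q_outside_tendsto: "(\<lambda>n. \<integral>y. outside n y \<partial>Q z) \<longlonglongrightarrow> 0"
proof -
  interpret Q: prob_space "Q z" by (rule Q_prob)
  have m: "outside n \<in> borel_measurable (Q z)" for n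
    using outside_bcontfun[of n] borel_measurable_continuous_onI[of "outside n"]
    by (simp add: measurable_cong_sets[OF Q_prob(2) refl] bcontfun_def)
  have lim: "(\<lambda>n. outside n y) \<longlonglongrightarrow> 0" for y
  proof (rule tendsto_eventually)
    obtain N :: nat where N: "norm y \<le> real N" using real_arch_simple by blast
    show "\<forall>\<^sub>F n in sequentially. outside n y = 0"
      using eventually_ge_at_top[of N] by eventually_elim (use N in \<open>auto simp: outside_def\<close>)
  qed
  have "(\<lambda>n. \<integral>y. outside n y \<partial>Q z) \<longlonglongrightarrow> (\<integral>y. 0 \<partial>Q z)"
    by (rule integral_dominated_convergence[where w="\<lambda>_. 1"])
      (use m lim outside_bounds in \<open>auto simp: abs_of_nonneg\<close>)
  then show ?thesis by simp
qed

text \<open>Three events must be controlled: one jump to a state in a ball \<open>B\<close> followed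
  by flow alone, a second jump starting from \<open>B\<close>, and a jump out of \<open>B\<close>.
  The first has a small integrand, the second has probability of order \<open>t\<close> times that
  of a jump, and the third has a small rate once \<open>B\<close> is large. The ball depends on
  \<open>z\<close> and \<open>\<eta>\<close> but not on \<open>t\<close>.\<close>

lemma later_jumps_negligible:
  assumes f: "f \<in> bcontfun" and C0: "uniform_limit UNIV (\<lambda>t. T t f) f (at_right 0)"
  shows "((\<lambda>t. (T t f z - exp (- cum_rate t z) * f (\<phi> t z) - first_jump_exp z t f) / t) \<longlongrightarrow> 0) (at_right 0)"
proof -
  interpret prob_space "P z" by (rule prob_P)
  have cont: "continuous_on UNIV f" using f by (simp add: bcontfun_def)
  have fm: "f \<in> borel_measurable borel" by (rule borel_measurable_continuous_onI[OF cont])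
  obtain C where C: "\<And>x. \<bar>f x\<bar> \<le> C"
    using f by (auto simp: bcontfun_def bounded_iff)
  have C0': "0 \<le> C" using C[of z] by linarith
  define p where "p t = measure (P z) (jumped z t)" for t
  \<comment> \<open>Of the \<open>3\<close>, the flow after the jump contributes \<open>2\<close>
    and the second jump \<open>1\<close>; \<open>2 * C\<close> stems from jumps out of the
    ball.\<close>
  have "((\<lambda>t. 3 * (p t / t) + 2 * C) \<longlongrightarrow> 3 * lam z + 2 * C) (at_right 0)"
    unfolding p_def by (intro tendsto_intros jumped_rate)
  then show ?thesis
  proof (rule tendsto_0_le_mult)
    fix \<eta> :: real assume \<eta>: "0 < \<eta>"
    have "(\<lambda>n. lam z * (\<integral>y. outside n y \<partial>Q z)) \<longlonglongrightarrow> lam z * 0"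
      by (intro tendsto_intros Q_outside_tendsto)
    then have "\<forall>\<^sub>F n in sequentially. lam z * (\<integral>y. outside n y \<partial>Q z) < \<eta>"
      by (rule order_tendstoD) (use \<eta> in simp)
    then obtain n where n: "lam z * (\<integral>y. outside n y \<partial>Q z) < \<eta>"
      unfolding eventually_sequentially by blast
    \<comment> \<open>Outside this closed ball \<open>outside n\<close> equals
      \<open>1\<close>.\<close>
    define B where "B = cball (0::'z) (real n + 1)"
    obtain K where K: "0 \<le> K" "\<And>t y. 0 \<le> t \<Longrightarrow> t \<le> 1 \<Longrightarrow> norm y \<le> real n + 1 \<Longrightarrow> cum_rate t y \<le> K * t"
      by (rule cum_rate_uniform[of "real n + 1"]) auto
    have "\<forall>\<^sub>F r in at_right 0. \<forall>y\<in>UNIV. dist (T r f y) (f y) < \<eta>"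
      by (rule uniform_limitD[OF C0 \<eta>])
    then obtain b where b: "0 < b" "\<And>r y. 0 < r \<Longrightarrow> r < b \<Longrightarrow> dist (T r f y) (f y) < \<eta>"
      unfolding eventually_at_right_field by auto
    have e1: "\<forall>\<^sub>F t in at_right 0. first_jump_exp z t (outside n) / t < \<eta>"
      by (rule order_tendstoD(2)[OF first_jump_exp_rate[OF outside_bcontfun] n])
    have "((\<lambda>t. 2 * C * K * t) \<longlongrightarrow> 2 * C * K * 0) (at_right (0::real))"
      by (intro tendsto_intros)
    then have e2: "\<forall>\<^sub>F t in at_right (0::real). 2 * C * K * t < \<eta>"
      by (rule order_tendstoD) (use \<eta> in simp)
    have e3: "\<forall>\<^sub>F t in at_right (0::real). t \<in> {0<..<min 1 b}" using b(1) by (intro eventually_at_right_real) simp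
    from e1 e2 e3
    show "\<forall>\<^sub>F t in at_right 0. \<bar>(T t f z - exp (- cum_rate t z) * f (\<phi> t z) - first_jump_exp z t f) / t\<bar>
        \<le> \<eta> * (3 * (p t / t) + 2 * C)"
    proof eventually_elim
      case (elim t)
      have t: "0 < t" "0 \<le> t" "t < 1" "t < b" using elim by auto
      let ?A = "{\<omega> \<in> space (P z). ennreal t < S 0 \<omega>}"
      let ?J = "jumped z t"
      \<comment> \<open>A second jump by time \<open>t\<close> forces
        \<open>S 1 \<omega> \<le> t\<close>. This larger event has a deterministic threshold in
        place of the random remaining time \<open>t - S 0 \<omega>\<close>.\<close>
      let ?J2 = "{\<omega> \<in> ?J. Y 1 \<omega> \<in> B \<and> S 1 \<omega> \<le> ennreal t}"
      let ?J3 = "{\<omega> \<in> ?J. Y 1 \<omega> \<notin> B}"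
      have A: "?A \<in> sets (P z)" using S_measurable by measurable
      have Bm: "B \<in> sets borel" by (simp add: B_def)
      have YB: "{\<omega> \<in> space (P z). Y 1 \<omega> \<in> B} \<in> sets (P z)" using Y_measurable Bm by measurable
      have S1: "{\<omega> \<in> space (P z). S 1 \<omega> \<le> ennreal t} \<in> sets (P z)" using S_measurable by measurable
      have "?J2 = ?J \<inter> {\<omega> \<in> space (P z). Y 1 \<omega> \<in> B} \<inter> {\<omega> \<in> space (P z). S 1 \<omega> \<le> ennreal t}"
        by (auto simp: jumped_def)
      then have J2: "?J2 \<in> sets (P z)" using jumped_sets YB S1 by auto
      have "?J3 = ?J - {\<omega> \<in> space (P z). Y 1 \<omega> \<in> B}" by (auto simp: jumped_def)
      then have J3: "?J3 \<in> sets (P z)" using jumped_sets YB by auto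
      have "(\<lambda>\<omega>. f (pdmp_path \<phi> S Y t \<omega>)) \<in> borel_measurable (P z)"
        by (rule measurable_compose[OF path_measurable[OF t(2)] fm])
      then have i1: "integrable (P z) (\<lambda>\<omega>. f (pdmp_path \<phi> S Y t \<omega>))"
        using C by (intro integrable_const_bound[of _ C]) auto
      have i2: "integrable (P z) (\<lambda>\<omega>. indicator ?A \<omega> * f (\<phi> t z))" using A by (simp add: emeasure_eq_measure)
      note i3 = jump_state_integrable[OF fm C, of z t]
      \<comment> \<open>Here \<open>y\<close> stands for the random state after the first jump and
        \<open>r\<close> for the time left, so the smallness of \<open>T r f - f\<close> has to be
        uniform in \<open>y\<close>; this is where the supremum norm in \<open>C0\<close> enters.
        The case \<open>r = 0\<close> lies outside the limit from the right.\<close>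
      have inc: "\<bar>f (\<phi> r y) - f y\<bar> \<le> \<eta> + \<eta>" if r: "0 \<le> r" "r \<le> t" and y: "y \<in> B" for r y
      proof (cases "r = 0")
        case True then show ?thesis using \<eta> by (simp add: flow_0)
      next
        case False
        have "\<bar>T r f y - f y\<bar> \<le> \<eta>" using b(2)[of r y] r False t by (simp add: dist_real_def)
        then have "\<bar>f (\<phi> r y) - f y\<bar> \<le> \<eta> + 2 * C * cum_rate r y" by (rule flow_increment[OF cont C r(1)])
        also have "2 * C * cum_rate r y \<le> 2 * C * (K * t)"
        proof (rule mult_left_mono)
          have "cum_rate r y \<le> K * r" using K(2)[of r y] r t y by (simp add: B_def)
          also have "\<dots> \<le> K * t" using K(1) r by (simp add: mult_left_mono)
          finally show "cum_rate r y \<le> K * t" .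
        qed (use C0' in simp)
        finally show ?thesis using elim(2) by (simp add: mult.assoc)
      qed
      \<comment> \<open>After a single jump into \<open>B\<close> the integrand is at most
        \<open>2 * \<eta>\<close>; on the two bad events the trivial bound \<open>2 * C\<close> is
        used.\<close>
      define bd where "bd \<omega> = indicator ?J \<omega> * (2 * \<eta>) + indicator ?J2 \<omega> * (2 * C) + indicator ?J3 \<omega> * (2 * C)" for \<omega>
      have ibd: "integrable (P z) bd" unfolding bd_def
        using jumped_sets J2 J3 by (simp add: emeasure_eq_measure)
      have "T t f z - exp (- cum_rate t z) * f (\<phi> t z) - first_jump_exp z t f =
          (\<integral>\<omega>. f (pdmp_path \<phi> S Y t \<omega>) - indicator ?A \<omega> * f (\<phi> t z) - indicator ?J \<omega> * f (Y 1 \<omega>) \<partial>P z)"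
        using A i1 i2 i3
        by (simp add: pdmp_semigroup_def no_jump_prob[OF t(2)] first_jump_exp_def)
      also have "\<bar>\<dots>\<bar> \<le> (\<integral>\<omega>. bd \<omega> \<partial>P z)"
      proof (rule abs_integral_le_AE)
        show "AE \<omega> in P z. \<bar>f (pdmp_path \<phi> S Y t \<omega>) - indicator ?A \<omega> * f (\<phi> t z) - indicator ?J \<omega> * f (Y 1 \<omega>)\<bar> \<le> bd \<omega>"
          using start[of z] AE_space
        proof eventually_elim
          case (elim \<omega>)
          have bd0: "0 \<le> bd \<omega>" using \<eta> C0' by (simp add: bd_def)
          show ?case
          proof (cases "ennreal t < S 0 \<omega>")
            case True
            then show ?thesis using elim bd0 by (simp add: pdmp_path_before_first_jump jumped_def)
          next
            case False
            then have J: "\<omega> \<in> ?J" and nA: "\<omega> \<notin> ?A" using elim by (auto simp: jumped_def)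
            show ?thesis
            proof (cases "Y 1 \<omega> \<in> B \<and> ennreal t < S 1 \<omega>")
              case True
              have "ennreal t < S 0 \<omega> + S 1 \<omega>" 
                using True by (auto intro: less_le_trans[of _ "S 1 \<omega>"])
              then have path: "pdmp_path \<phi> S Y t \<omega> = \<phi> (t - enn2real (S 0 \<omega>)) (Y 1 \<omega>)"
                using J by (intro pdmp_path_after_first_jump) (auto simp: jumped_def)
              have "enn2real (S 0 \<omega>) \<le> t" using J t by (auto simp: jumped_def intro: enn2real_leI)
              then have "\<bar>f (\<phi> (t - enn2real (S 0 \<omega>)) (Y 1 \<omega>)) - f (Y 1 \<omega>)\<bar> \<le> \<eta> + \<eta>"
                using True by (intro inc) auto
              then show ?thesis using J nA C0' by (simp add: path bd_def add_increasing2)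
            next
              case False
              then have "\<omega> \<in> ?J2 \<or> \<omega> \<in> ?J3" using J by (auto simp: not_less)
              then have "2 * C \<le> bd \<omega>" using \<eta> C0' by (auto simp: bd_def split: split_indicator)
              then show ?thesis using J nA C[of "pdmp_path \<phi> S Y t \<omega>"] C[of "Y 1 \<omega>"] by simp
            qed
          qed
        qed
      qed (use i1 i2 i3 ibd in auto)
      also have "(\<integral>\<omega>. bd \<omega> \<partial>P z) = 2 * \<eta> * p t + 2 * C * measure (P z) ?J2 + 2 * C * measure (P z) ?J3"
        unfolding bd_def p_def using jumped_sets J2 J3
        by (simp add: emeasure_eq_measure mult.commute)
      also have "\<dots> \<le> 2 * \<eta> * p t + \<eta> * p t + 2 * C * (\<eta> * t)"
      proof (intro add_mono order.refl)
        have "measure (P z) ?J2 \<le> (K * t) * p t"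
          unfolding p_def using K t by (intro second_jump_prob Bm) (auto simp: B_def)
        then have "2 * C * measure (P z) ?J2 \<le> 2 * C * ((K * t) * p t)" using C0' by (intro mult_left_mono) auto
        also have "\<dots> = (2 * C * K * t) * p t" by simp
        also have "\<dots> \<le> \<eta> * p t" using elim(2) by (intro mult_right_mono) (auto simp: p_def)
        finally show "2 * C * measure (P z) ?J2 \<le> \<eta> * p t" .
        have om: "outside n \<in> borel_measurable borel" "\<And>x. \<bar>outside n x\<bar> \<le> 1"
          using outside_bcontfun[of n] outside_bounds[of n]
          by (auto simp: bcontfun_def intro!: borel_measurable_continuous_onI)
        have "measure (P z) ?J3 = (\<integral>\<omega>. indicator ?J3 \<omega> \<partial>P z)" using J3 by simp
        also have "\<dots> \<le> first_jump_exp z t (outside n)"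
          unfolding first_jump_exp_def
        proof (rule integral_mono[OF _ jump_state_integrable[OF om]])
          show "integrable (P z) (indicator ?J3 :: _ \<Rightarrow> real)" using J3 by (simp add: emeasure_eq_measure)
          fix \<omega>
          show "indicator ?J3 \<omega> \<le> indicator ?J \<omega> * outside n (Y 1 \<omega>)"
            by (auto simp: B_def outside_def split: split_indicator)
        qed
        also have "\<dots> \<le> \<eta> * t" using elim(1) t by (simp add: field_simps)
        finally show "2 * C * measure (P z) ?J3 \<le> 2 * C * (\<eta> * t)" using C0' by (intro mult_left_mono) auto
      qed
      finally have "\<bar>T t f z - exp (- cum_rate t z) * f (\<phi> t z) - first_jump_exp z t f\<bar> \<le> \<eta> * (3 * p t + 2 * C * t)"
        by (simp add: algebra_simps)
      then have "\<bar>T t f z - exp (- cum_rate t z) * f (\<phi> t z) - first_jump_exp z t f\<bar> / t \<le> \<eta> * (3 * p t + 2 * C * t) / t"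
        using t by (simp add: divide_right_mono)
      also have "\<dots> = \<eta> * (3 * (p t / t) + 2 * C)" using t by (simp add: field_simps)
      finally show ?case using t by (simp add: abs_divide)
    qed
  qed
qed

text \<open>The decomposition
  \<open>T t f z = a t * f (\<phi> t z) + first_jump_exp z t f + D t\<close> is solved for
  \<open>f (\<phi> t z) - f z\<close>. Differentiability of \<open>f\<close> along the flow is thus
  a consequence of convergence of the semigroup quotient.\<close>

lemma flow_derivative_pointwise:
  assumes f: "f \<in> bcontfun" and C0: "uniform_limit UNIV (\<lambda>t. T t f) f (at_right 0)"
    and h: "((\<lambda>t. (T t f z - f z) / t) \<longlongrightarrow> h) (at_right 0)"
  shows "((\<lambda>t. (f (\<phi> t z) - f z) / t) \<longlongrightarrow> h - lam z * ((\<integral>y. f y \<partial>Q z) - f z)) (at_right 0)"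
proof -
  define a where "a t = exp (- cum_rate t z)" for t
  have a: "(a \<longlongrightarrow> 1) (at_right 0)" unfolding a_def by (rule cum_rate_tendsto)
  have a': "((\<lambda>t. (1 - a t) / t) \<longlongrightarrow> lam z) (at_right 0)" unfolding a_def by (rule jump_prob_rate)
  define D where "D t = T t f z - a t * f (\<phi> t z) - first_jump_exp z t f" for t
  have D: "((\<lambda>t. D t / t) \<longlongrightarrow> 0) (at_right 0)"
    unfolding D_def a_def by (rule later_jumps_negligible[OF f C0])
  have "((\<lambda>t. ((T t f z - f z) / t - D t / t - first_jump_exp z t f / t + f z * ((1 - a t) / t)) / a t) \<longlongrightarrow>
      (h - 0 - lam z * (\<integral>y. f y \<partial>Q z) + f z * lam z) / 1) (at_right 0)"
    by (intro tendsto_intros h D a a' first_jump_exp_rate[OF f]) simp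
  moreover have "((T t f z - f z) / t - D t / t - first_jump_exp z t f / t + f z * ((1 - a t) / t)) / a t = (f (\<phi> t z) - f z) / t" for t
  proof -
    have "(T t f z - f z) / t - D t / t - first_jump_exp z t f / t + f z * ((1 - a t) / t) =
        (T t f z - f z - D t - first_jump_exp z t f + f z * (1 - a t)) / t"
      by (simp add: diff_divide_distrib add_divide_distrib right_diff_distrib)
    also have "T t f z - f z - D t - first_jump_exp z t f + f z * (1 - a t) = a t * (f (\<phi> t z) - f z)"
      by (simp add: D_def algebra_simps)
    finally show ?thesis by (simp add: a_def)
  qed
  ultimately show ?thesis by (simp add: algebra_simps)
qed

end

section \<open>Generator and balance\<close>

lemma L2_iff: "f \<in> L2 M \<longleftrightarrow> f \<in> borel_measurable M \<and> integrable M (\<lambda>x. (f x)\<^sup>2)"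
  by (simp add: L2_def)

lemma L2_cmult:
  assumes "f \<in> L2 M" shows "(\<lambda>x. c * f x) \<in> L2 M"
  using assms by (auto simp: L2_iff power_mult_distrib)

lemma L2_mult_integrable:
  assumes "f \<in> L2 M" "g \<in> L2 M" shows "integrable M (\<lambda>x. f x * g x)"
proof (rule Bochner_Integration.integrable_bound)
  show "integrable M (\<lambda>x. (f x)\<^sup>2 + (g x)\<^sup>2)" using assms by (simp add: L2_def)
  show "(\<lambda>x. f x * g x) \<in> borel_measurable M" using assms by (auto simp: L2_iff)
  have "\<bar>f x * g x\<bar> \<le> (f x)\<^sup>2 + (g x)\<^sup>2" for x
  proof -
    have "0 \<le> (\<bar>f x\<bar> - \<bar>g x\<bar>)\<^sup>2" "0 \<le> \<bar>f x\<bar> * \<bar>g x\<bar>" by simp_all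
    then have "2 * (\<bar>f x\<bar> * \<bar>g x\<bar>) \<le> (f x)\<^sup>2 + (g x)\<^sup>2" by (simp add: power2_diff)
    with \<open>0 \<le> \<bar>f x\<bar> * \<bar>g x\<bar>\<close> show ?thesis unfolding abs_mult by linarith
  qed
  then show "AE x in M. norm (f x * g x) \<le> norm ((f x)\<^sup>2 + (g x)\<^sup>2)" by simp
qed

lemma L2_diff:
  assumes f: "f \<in> L2 M" and g: "g \<in> L2 M" shows "(\<lambda>x. f x - g x) \<in> L2 M"
proof -
  have "integrable M (\<lambda>x. (f x)\<^sup>2 + (g x)\<^sup>2 - 2 * (f x * g x))"
    using f g L2_mult_integrable[OF f g] by (simp add: L2_def)
  then have "integrable M (\<lambda>x. (f x - g x)\<^sup>2)"
    by (simp add: power2_diff mult.assoc)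
  then show ?thesis using f g by (auto simp: L2_iff)
qed

text \<open>Fatou's lemma along the times \<open>1 / (n + 1)\<close>: the integrals of the squared
  errors tend to \<open>0\<close>, so their pointwise lower limit vanishes almost everywhere, and
  that lower limit is \<open>(d z - g z)^2\<close>.\<close>

lemma has_flow_deriv_pointwise:
  assumes g: "has_flow_deriv \<phi> \<mu> f g"
    and d: "\<And>z. ((\<lambda>t. (f (\<phi> t z) - f z) / t) \<longlongrightarrow> d z) (at_right 0)"
  shows "AE z in \<mu>. g z = d z"
proof -
  define r :: "nat \<Rightarrow> real" where "r n = inverse (real (Suc n))" for n
  have r0: "0 < r n" for n by (simp add: r_def)
  have r: "filterlim r (at_right 0) sequentially"
    unfolding filterlim_at using r0 LIMSEQ_inverse_real_of_nat by (auto simp: r_def[abs_def])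
  have fL: "f \<in> L2 \<mu>" and gL: "g \<in> L2 \<mu>"
    and ev: "\<forall>\<^sub>F t in at_right 0. (\<lambda>z. f (\<phi> t z)) \<in> L2 \<mu>"
    and lim: "((\<lambda>t. \<integral>z. ((f (\<phi> t z) - f z) / t - g z)\<^sup>2 \<partial>\<mu>) \<longlongrightarrow> 0) (at_right 0)"
    using g by (auto simp: has_flow_deriv_def)
  have "\<forall>\<^sub>F n in sequentially. (\<lambda>z. f (\<phi> (r n) z)) \<in> L2 \<mu>"
    using filterlim_iff[THEN iffD1, OF r] ev by blast
  \<comment> \<open>Square integrability of \<open>f\<close> along the flow holds only for small
    times, hence the shift of the sequence.\<close>
  then obtain N where N: "\<And>n. (\<lambda>z. f (\<phi> (r (n + N)) z)) \<in> L2 \<mu>"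
    unfolding eventually_sequentially by (metis le_add2)
  define u where "u n z = ((f (\<phi> (r (n + N)) z) - f z) / r (n + N) - g z)\<^sup>2" for n z
  have rN: "filterlim (\<lambda>n. r (n + N)) (at_right 0) sequentially"
    by (rule filterlim_compose[OF r filterlim_add_const_nat_at_top])
  have L: "(\<lambda>z. (f (\<phi> (r (n + N)) z) - f z) / r (n + N) - g z) \<in> L2 \<mu>" for n
    using L2_diff[OF L2_cmult[OF L2_diff[OF N fL], of "1 / r (n + N)"] gL] by simp
  then have ui: "integrable \<mu> (u n)" for n by (simp add: L2_def u_def[abs_def])
  have um: "u n \<in> borel_measurable \<mu>" for n using ui by (rule borel_measurable_integrable)
  have u0: "0 \<le> u n z" for n z by (simp add: u_def)
  have "(\<lambda>n. \<integral>z. u n z \<partial>\<mu>) \<longlonglongrightarrow> 0"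
    unfolding u_def by (rule filterlim_compose[OF lim rN])
  then have "(\<lambda>n. ennreal (\<integral>z. u n z \<partial>\<mu>)) \<longlonglongrightarrow> ennreal 0" by (rule tendsto_ennrealI)
  moreover have "(\<integral>\<^sup>+z. ennreal (u n z) \<partial>\<mu>) = ennreal (\<integral>z. u n z \<partial>\<mu>)" for n
    by (rule nn_integral_eq_integral[OF ui]) (simp add: u0)
  ultimately have "liminf (\<lambda>n. \<integral>\<^sup>+z. ennreal (u n z) \<partial>\<mu>) = 0"
    using lim_imp_Liminf[OF sequentially_bot] by fastforce
  moreover have "(\<integral>\<^sup>+z. liminf (\<lambda>n. ennreal (u n z)) \<partial>\<mu>) \<le> liminf (\<lambda>n. \<integral>\<^sup>+z. ennreal (u n z) \<partial>\<mu>)"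
    using um by (intro nn_integral_liminf) auto
  ultimately have "(\<integral>\<^sup>+z. liminf (\<lambda>n. ennreal (u n z)) \<partial>\<mu>) = 0" by simp
  then have "AE z in \<mu>. liminf (\<lambda>n. ennreal (u n z)) = 0"
    using um by (subst (asm) nn_integral_0_iff_AE) auto
  moreover have "liminf (\<lambda>n. ennreal (u n z)) = ennreal ((d z - g z)\<^sup>2)" for z
  proof -
    have "(\<lambda>n. u n z) \<longlonglongrightarrow> (d z - g z)\<^sup>2"
      unfolding u_def by (intro tendsto_intros filterlim_compose[OF d rN])
    then have "(\<lambda>n. ennreal (u n z)) \<longlonglongrightarrow> ennreal ((d z - g z)\<^sup>2)" by (rule tendsto_ennrealI)
    then show ?thesis by (rule lim_imp_Liminf[OF sequentially_bot])
  qed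
  ultimately have "AE z in \<mu>. d z = g z" by simp
  then show ?thesis by eventually_elim simp
qed

text \<open>\<open>LX\<close> is an arbitrary choice among the mean-square limits; a pointwise limit
  determines it up to a null set.\<close>

lemma LX_pointwise:
  assumes f: "f \<in> LX_dom \<phi> \<mu>"
    and d: "\<And>z. ((\<lambda>t. (f (\<phi> t z) - f z) / t) \<longlongrightarrow> d z) (at_right 0)"
  shows "AE z in \<mu>. LX \<phi> \<mu> f z = d z"
proof -
  have "has_flow_deriv \<phi> \<mu> f (LX \<phi> \<mu> f)"
    using f unfolding LX_dom_def LX_def by (auto intro: someI[of "has_flow_deriv \<phi> \<mu> f"])
  then show ?thesis using d by (rule has_flow_deriv_pointwise)
qed

section \<open>The generator formula\<close>

lemma has_generator_unique:
  assumes "has_generator T f h" "has_generator T f h'" shows "h = h'"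
proof
  fix z
  have "((\<lambda>t. (T t f z - f z) / t) \<longlongrightarrow> h z) (at_right 0)" "((\<lambda>t. (T t f z - f z) / t) \<longlongrightarrow> h' z) (at_right 0)"
    using assms tendsto_uniform_limitI[where S=UNIV] by (force simp: has_generator_def)+
  then show "h z = h' z" by (rule tendsto_unique[OF trivial_limit_at_right_real])
qed

lemma has_generator_generator:
  assumes "f \<in> generator_dom T" shows "has_generator T f (generator T f)"
proof -
  obtain h where h: "has_generator T f h" using assms by (auto simp: generator_dom_def)
  show ?thesis unfolding generator_def
    by (rule theI[of _ h]) (use h has_generator_unique in blast)+
qed

text \<open>The usual formula for the generator, solved for the flow derivative and deduced from the
  path description of the process.\<close>

lemma (in pdmp_W) LX_generator:
  assumes dom: "f \<in> generator_dom T" and f: "f \<in> LX_dom \<phi> \<mu>"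
  shows "AE z in \<mu>. LX \<phi> \<mu> f z = generator T f z - lam z * ((\<integral>y. f y \<partial>Q z) - f z)"
proof (rule LX_pointwise[OF f])
  fix z
  have gen: "has_generator T f (generator T f)" by (rule has_generator_generator[OF dom])
  show "((\<lambda>t. (f (\<phi> t z) - f z) / t) \<longlongrightarrow> generator T f z - lam z * ((\<integral>y. f y \<partial>Q z) - f z)) (at_right 0)"
    using gen
    by (intro flow_derivative_pointwise)
      (auto simp: has_generator_def C0_def dest: tendsto_uniform_limitI[where x=z])
qed

section \<open>Flux through spheres and the balance of jumps\<close>

lemma indicator_ball_tendsto:
  "(\<lambda>n. indicator (ball 0 (real n + 1)) y :: real) \<longlonglongrightarrow> 1" for y :: "'z::real_normed_vector"
proof (rule tendsto_eventually)
  obtain N :: nat where N: "norm y \<le> real N" using real_arch_simple by blast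
  show "\<forall>\<^sub>F n in sequentially. indicator (ball 0 (real n + 1)) y = (1::real)"
    using eventually_ge_at_top[of N] by eventually_elim (use N in auto)
qed

text \<open>By W3 a reflection from inside the ball lands at no larger norm and stays inside. Only
  refreshments leave, at total rate at most \<open>lr z\<close>, which W6 bounds independently of
  the radius.\<close>

lemma (in assumption_W) outward_rate:
  assumes B: "B = ball 0 (r::real)" and z: "z \<in> B"
  shows "lam z * (\<integral>y. indicator (- B) y \<partial>Q z) \<le> lr z"
proof -
  interpret Qb: prob_space "Qb z" by (rule Qb_prob)
  interpret Qr: prob_space "Qr z" by (rule Qr_prob)
  have m: "- B \<in> sets borel" by (simp add: B)
  have sb: "space (Qb z) = UNIV" using sets_eq_imp_space_eq[OF Qb_prob(2)] by simp
  have "measure (Qb z) (- B) \<le> measure (Qb z) (space (Qb z) - {y. norm y \<le> norm z})"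
    using z by (intro Qb.finite_measure_mono) (auto simp: B sb Qb_prob(2))
  also have "\<dots> = 0" using W3[of z] by (subst Qb.prob_compl) (auto simp: Qb_prob(2))
  finally have b: "measure (Qb z) (- B) = 0" by (simp add: measure_le_0_iff)
  have "lam z * (\<integral>y. indicator (- B) y \<partial>Q z) = lr z * (\<integral>y. indicator (- B) y \<partial>Qr z) + lb z * (\<integral>y. indicator (- B) y \<partial>Qb z)"
    using m by (intro Q_mixture_integral[of _ 1]) auto
  also have "\<dots> = lr z * measure (Qr z) (- B)"
    using m b by (simp add: Qr_prob Qb_prob)
  also have "\<dots> \<le> lr z * 1" using lr_nonneg by (intro mult_left_mono Qr.prob_le_1)
  finally show ?thesis by simp
qed

text \<open>The rate \<open>lam\<close> need not be integrable against the target measure, so \<open>Q\<close> and its reversal are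
  exchanged on balls only. The error is the mass jumping across the sphere: the outward flux is
  small because only the bounded refreshment rate causes it, and then the inward flux is small
  because the two balance up to \<open>\<integral> k\<close> over the ball.\<close>

lemma (in assumption_W) weak_balance:
  fixes \<mu> :: "'z measure" and e k f :: "'z \<Rightarrow> real"
  assumes \<mu>: "prob_space \<mu>" "sets \<mu> = sets borel"
    and rev: "reversed_kernel \<mu> Q Qs"
    and e: "e \<in> borel_measurable borel" "\<And>z. 0 \<le> e z" "\<And>z. e z \<le> E"
    and k: "integrable \<mu> k" "(\<integral>z. k z \<partial>\<mu>) = 0"
    and bal: "AE z in \<mu>. integrable (Qs z) (\<lambda>y. lam y * e y) \<and> k z = lam z * e z - (\<integral>y. lam y * e y \<partial>Qs z)"
    and f: "f \<in> borel_measurable borel" "\<And>z. 0 \<le> f z" "\<And>z. f z \<le> C"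
    and int: "integrable \<mu> (\<lambda>z. lam z * e z * ((\<integral>y. f y \<partial>Q z) - f z))"
  shows "(\<integral>z. f z * k z \<partial>\<mu>) = - (\<integral>z. lam z * e z * ((\<integral>y. f y \<partial>Q z) - f z) \<partial>\<mu>)"
proof -
  interpret \<mu>: prob_space \<mu> by (rule \<mu>)
  define w where "w z = lam z * e z" for z
  have w0: "0 \<le> w z" for z using lam_nonneg e(2) by (simp add: w_def)
  have wm: "w \<in> borel_measurable borel"
    using borel_measurable_continuous_onI[OF lam_cont] e(1) by (simp add: w_def[abs_def])
  have mu: "g \<in> borel_measurable \<mu>" if "g \<in> borel_measurable borel" for g :: "'z \<Rightarrow> real"
    using that by (simp add: measurable_cong_sets[OF \<mu>(2) refl])
  have C0: "0 \<le> C" using f(2,3)[of 0] by linarith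
  have E0: "0 \<le> E" using e(2,3)[of 0] by linarith
  obtain M where M: "\<And>z. lr z \<le> M" using W6 by blast
  have M0: "0 \<le> M" using M[of 0] lr_nonneg[of 0] by linarith
  define B where "B n = ball (0::'z) (real n + 1)" for n :: nat
  define I where "I n = (indicator (B n) :: 'z \<Rightarrow> real)" for n
  have Im: "I n \<in> borel_measurable borel" for n
    unfolding I_def B_def by (intro borel_measurable_indicator) simp
  have I01: "I n z = 0 \<or> I n z = 1" for n z by (simp add: I_def indicator_def)
  have Ilim: "(\<lambda>n. I n z) \<longlonglongrightarrow> 1" for z unfolding I_def B_def by (rule indicator_ball_tendsto)
  \<comment> \<open>W5 and W6 bound \<open>lam\<close> on each ball, so a cut-off restores
    integrability of \<open>w\<close>.\<close>
  have Iw: "integrable \<mu> (\<lambda>z. a z * w z)"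
    if a: "a \<in> borel_measurable borel" "\<And>z. \<bar>a z\<bar> \<le> D * I n z" for a D n
  proof -
    obtain L where L: "\<And>z. z \<in> B n \<Longrightarrow> lb z \<le> L"
      using W5[of "real n + 1"] unfolding bdd_above_def B_def by (metis image_eqI add_nonneg_pos of_nat_0_le_iff zero_less_one)
    have "\<bar>a z * w z\<bar> \<le> \<bar>D\<bar> * ((M + \<bar>L\<bar>) * E)" for z
    proof (cases "z \<in> B n")
      case True
      have "lam z \<le> M + \<bar>L\<bar>" using L[OF True] M[of z] by (simp add: lam_eq)
      then have "w z \<le> (M + \<bar>L\<bar>) * E" unfolding w_def using e lam_nonneg M0 by (intro mult_mono) auto
      moreover have "\<bar>a z\<bar> \<le> \<bar>D\<bar>" using a(2)[of z] True by (simp add: I_def)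
      ultimately show ?thesis using w0[of z] by (simp add: abs_mult mult_mono)
    next
      case False
      then have "a z = 0" using a(2)[of z] by (simp add: I_def)
      then show ?thesis using M0 E0 by simp
    qed
    then show ?thesis using mu[OF a(1)] mu[OF wm]
      by (intro \<mu>.integrable_const_bound[of _ "\<bar>D\<bar> * ((M + \<bar>L\<bar>) * E)"]) auto
  qed
  have ak: "integrable \<mu> (\<lambda>z. a z * k z)"
    if a: "a \<in> borel_measurable borel" "\<And>z. \<bar>a z\<bar> \<le> D" for a D
  proof (rule Bochner_Integration.integrable_bound)
    show "integrable \<mu> (\<lambda>z. D * k z)" using k(1) by simp
    show "(\<lambda>z. a z * k z) \<in> borel_measurable \<mu>" using mu[OF a(1)] k(1) by simp
    have "\<bar>a z * k z\<bar> \<le> \<bar>D * k z\<bar>" for z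
      using a(2)[of z] by (simp add: abs_mult mult_right_mono)
    then show "AE z in \<mu>. norm (a z * k z) \<le> norm (D * k z)" by simp
  qed
  \<comment> \<open>The reversal moves the kernel from \<open>a\<close> to \<open>w\<close>, and the
    balance equation then replaces the integral of \<open>w\<close> against \<open>Qs y\<close> by
    \<open>w y - k y\<close>. The result is localised by \<open>a\<close> and finite, which proves
    integrability on the other side, where \<open>w\<close> is not cut off.\<close>
  have exch: "integrable \<mu> (\<lambda>z. w z * (\<integral>y. a y \<partial>Q z)) \<and>
      (\<integral>z. a z * k z \<partial>\<mu>) = (\<integral>z. a z * w z \<partial>\<mu>) - (\<integral>z. w z * (\<integral>y. a y \<partial>Q z) \<partial>\<mu>)"
    if a: "a \<in> borel_measurable borel" "\<And>z. 0 \<le> a z" "\<And>z. a z \<le> D * I n z" for a D n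
  proof -
    have aD: "\<bar>a z\<bar> \<le> D * I n z" for z using a(2,3) by simp
    have aD': "\<bar>a z\<bar> \<le> \<bar>D\<bar>" for z using aD[of z] I01[of n z] by auto
    note iaw = Iw[OF a(1) aD] and iak = ak[OF a(1) aD']
    have Qa0: "0 \<le> (\<integral>y. a y \<partial>Q z)" for z using a(2) by simp
    have Qam: "(\<lambda>z. w z * (\<integral>y. a y \<partial>Q z)) \<in> borel_measurable \<mu>"
      by (intro borel_measurable_times mu wm Q_integral_measurable[OF a(1) aD'])
    have posAE: "AE y in \<mu>. 0 \<le> a y * w y - a y * k y"
      using bal
    proof eventually_elim
      case (elim y)
      have "0 \<le> (\<integral>z. w z \<partial>Qs y)" using w0 by simp
      then have "0 \<le> w y - k y" using elim by (simp add: w_def)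
      then show ?case using a(2)[of y] by (simp add: right_diff_distrib[symmetric])
    qed
    have pos: "0 \<le> (\<integral>y. a y * w y - a y * k y \<partial>\<mu>)" by (rule integral_nonneg_AE[OF posAE])
    have "(\<integral>\<^sup>+z. ennreal (w z * (\<integral>y. a y \<partial>Q z)) \<partial>\<mu>) = (\<integral>\<^sup>+z. ennreal (w z) * (\<integral>\<^sup>+y. ennreal (a y) \<partial>Q z) \<partial>\<mu>)"
      using w0 Qa0 by (simp add: Q_nn_integral[OF a(1) aD' a(2)] ennreal_mult)
    also have "\<dots> = (\<integral>\<^sup>+y. ennreal (a y) * (\<integral>\<^sup>+z. ennreal (w z) \<partial>Qs y) \<partial>\<mu>)"
      by (rule reversed_kernel_nn[OF \<mu> Q_kernel rev, symmetric]) (use a(1) wm in auto)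
    also have "\<dots> = (\<integral>\<^sup>+y. ennreal (a y * w y - a y * k y) \<partial>\<mu>)"
    proof (rule nn_integral_cong_AE)
      show "AE y in \<mu>. ennreal (a y) * (\<integral>\<^sup>+z. ennreal (w z) \<partial>Qs y) = ennreal (a y * w y - a y * k y)"
        using bal
      proof eventually_elim
        case (elim y)
        have "(\<integral>\<^sup>+z. ennreal (w z) \<partial>Qs y) = ennreal (\<integral>z. w z \<partial>Qs y)"
          using elim w0 by (intro nn_integral_eq_integral) (auto simp: w_def)
        then have "ennreal (a y) * (\<integral>\<^sup>+z. ennreal (w z) \<partial>Qs y) = ennreal (a y * (\<integral>z. w z \<partial>Qs y))"
          using a(2) w0 by (simp add: ennreal_mult)
        moreover have "(\<integral>z. w z \<partial>Qs y) = w y - k y" using elim by (simp add: w_def)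
        ultimately show ?case by (simp add: right_diff_distrib)
      qed
    qed
    also have "\<dots> = ennreal (\<integral>y. a y * w y - a y * k y \<partial>\<mu>)"
    proof (rule nn_integral_eq_integral)
      show "integrable \<mu> (\<lambda>y. a y * w y - a y * k y)" using iaw iak by simp
      show "AE y in \<mu>. 0 \<le> a y * w y - a y * k y" by (rule posAE)
    qed
    finally have eq: "(\<integral>\<^sup>+z. ennreal (w z * (\<integral>y. a y \<partial>Q z)) \<partial>\<mu>) = ennreal (\<integral>y. a y * w y - a y * k y \<partial>\<mu>)" .
    have iQ: "integrable \<mu> (\<lambda>z. w z * (\<integral>y. a y \<partial>Q z))"
      using eq w0 Qa0 by (intro integrableI_nonneg Qam) auto
    have "(\<integral>z. w z * (\<integral>y. a y \<partial>Q z) \<partial>\<mu>) = (\<integral>y. a y * w y - a y * k y \<partial>\<mu>)"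
      using eq pos w0 Qa0 by (subst (asm) nn_integral_eq_integral[OF iQ]) (auto simp: ennreal_inj integral_nonneg_AE)
    then show ?thesis using iQ iaw iak by simp
  qed
  have fC: "\<bar>f z\<bar> \<le> C" for z using f(2,3)[of z] by simp
  have I1: "\<bar>I n z\<bar> \<le> 1" for n z using I01[of n z] by auto
  have Qf: "integrable (Q z) f" for z by (rule Q_integrable[OF f(1) fC])
  have QI: "integrable (Q z) (I n)" for n z by (rule Q_integrable[OF Im I1])
  have fI: "(\<lambda>z. f z * I n z) \<in> borel_measurable borel" "\<bar>f z * I n z\<bar> \<le> C" for n z
    using f(1) Im fC[of z] C0 I01[of n z] by auto
  have QfI: "integrable (Q z) (\<lambda>z. f z * I n z)" for n z by (rule Q_integrable[OF fI])
  \<comment> \<open>The outward flux density: the weight \<open>w z\<close> times the mass that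
    \<open>Q z\<close> sends from inside the ball to its complement.\<close>
  define out where "out n z = I n z * w z * (1 - (\<integral>y. I n y \<partial>Q z))" for n z
  have QI_le: "(\<integral>y. I n y \<partial>Q z) \<le> 1" for n z using Q_integral_abs_le[OF Im I1, of z n] by linarith
  have out0: "0 \<le> out n z" for n z
    unfolding out_def using I01[of n z] w0[of z] QI_le[of z n] by auto
  \<comment> \<open>A bound free of \<open>n\<close>, so that dominated convergence applies although
    \<open>w\<close> itself may be non-integrable.\<close>
  have out_le: "out n z \<le> M * E" for n z
  proof (cases "z \<in> B n")
    case True
    interpret Q: prob_space "Q z" by (rule Q_prob)
    have "(\<integral>y. indicator (- B n) y \<partial>Q z) = (\<integral>y. 1 - I n y \<partial>Q z)"
      by (rule Bochner_Integration.integral_cong) (auto simp: I_def indicator_def)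
    also have "\<dots> = 1 - (\<integral>y. I n y \<partial>Q z)" using QI by (simp add: Q.prob_space)
    finally have "out n z = lam z * (\<integral>y. indicator (- B n) y \<partial>Q z) * e z"
      using True by (simp add: out_def w_def I_def)
    also have "\<dots> \<le> M * E"
      using order.trans[OF outward_rate[OF B_def True] M[of z]] e M0 by (intro mult_mono) auto
    finally show ?thesis .
  next
    case False then show ?thesis using M0 E0 by (simp add: out_def I_def)
  qed
  have outm: "out n \<in> borel_measurable \<mu>" for n
    unfolding out_def[abs_def] by (intro mu borel_measurable_times borel_measurable_diff Im wm borel_measurable_const Q_integral_measurable[OF Im I1])
  have out_int: "integrable \<mu> (out n)" for n
    using out0 out_le outm by (intro \<mu>.integrable_const_bound[of _ "M * E"]) auto
  have "(\<lambda>n. \<integral>z. out n z \<partial>\<mu>) \<longlonglongrightarrow> (\<integral>z. 0 \<partial>\<mu>)"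
  proof (rule integral_dominated_convergence[where w="\<lambda>_. M * E"])
    have "(\<lambda>n. out n z) \<longlonglongrightarrow> 1 * w z * (1 - 1)" for z
      unfolding out_def
    proof (intro tendsto_intros Ilim)
      interpret Q: prob_space "Q z" by (rule Q_prob)
      have "(\<lambda>n. \<integral>y. I n y \<partial>Q z) \<longlonglongrightarrow> (\<integral>y. 1 \<partial>Q z)"
        by (rule integral_dominated_convergence[where w="\<lambda>_. 1"])
          (use QI Ilim I1 in auto)
      then show "(\<lambda>n. \<integral>y. I n y \<partial>Q z) \<longlonglongrightarrow> 1" by (simp add: Q.prob_space)
    qed
    then show "AE z in \<mu>. (\<lambda>n. out n z) \<longlonglongrightarrow> 0" by simp
  qed (use outm out0 out_le in auto)
  then have out_lim: "(\<lambda>n. \<integral>z. out n z \<partial>\<mu>) \<longlonglongrightarrow> 0" by simp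
  have dom: "(\<lambda>n. \<integral>z. I n z * g z \<partial>\<mu>) \<longlonglongrightarrow> (\<integral>z. g z \<partial>\<mu>)" if g: "integrable \<mu> g" for g
  proof (rule integral_dominated_convergence[where w="\<lambda>z. \<bar>g z\<bar>"])
    show "AE z in \<mu>. (\<lambda>n. I n z * g z) \<longlonglongrightarrow> g z"
      using tendsto_mult[OF Ilim tendsto_const] by (intro AE_I2) fastforce
    show "AE z in \<mu>. norm (I n z * g z) \<le> \<bar>g z\<bar>" for n
      using I1[of n] by (intro AE_I2) (simp add: abs_mult mult_left_le_one_le)
  qed (use g mu[OF Im] in auto)
  define A where "A n = (\<integral>z. I n z * (f z * k z) \<partial>\<mu>) + (\<integral>z. I n z * (w z * ((\<integral>y. f y \<partial>Q z) - f z)) \<partial>\<mu>)" for n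
  have ifk: "integrable \<mu> (\<lambda>z. f z * k z)" by (rule ak[OF f(1) fC])
  have int': "integrable \<mu> (\<lambda>z. w z * ((\<integral>y. f y \<partial>Q z) - f z))" using int by (simp add: w_def)
  have A_lim: "A \<longlonglongrightarrow> (\<integral>z. f z * k z \<partial>\<mu>) + (\<integral>z. w z * ((\<integral>y. f y \<partial>Q z) - f z) \<partial>\<mu>)"
    unfolding A_def by (intro tendsto_add dom ifk int')
  \<comment> \<open>The defect \<open>A n\<close> is at most \<open>C\<close> times the total flux,
    outward plus inward. Testing \<open>exch\<close> with \<open>I n\<close> gives outward minus
    inward flux as the integral of \<open>k\<close> over the ball, so the total is twice the outward
    flux minus that integral.\<close>
  have A_le: "\<bar>A n\<bar> \<le> C * (2 * (\<integral>z. out n z \<partial>\<mu>) - (\<integral>z. I n z * k z \<partial>\<mu>))" for n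
  proof -
    have 1: "integrable \<mu> (\<lambda>z. w z * (\<integral>y. I n y \<partial>Q z))"
      "(\<integral>z. I n z * k z \<partial>\<mu>) = (\<integral>z. I n z * w z \<partial>\<mu>) - (\<integral>z. w z * (\<integral>y. I n y \<partial>Q z) \<partial>\<mu>)"
      using exch[of "I n" 1 n] Im I01 by (auto simp: I_def)
    have "0 \<le> f z * I n z" "f z * I n z \<le> C * I n z" for z
      using f(2,3)[of z] I01[of n z] by auto
    then have 2: "integrable \<mu> (\<lambda>z. w z * (\<integral>y. f y * I n y \<partial>Q z))"
      "(\<integral>z. f z * I n z * k z \<partial>\<mu>) = (\<integral>z. f z * I n z * w z \<partial>\<mu>) - (\<integral>z. w z * (\<integral>y. f y * I n y \<partial>Q z) \<partial>\<mu>)"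
      using exch[OF fI(1)[of n], of C n] by auto
    have iIw: "integrable \<mu> (\<lambda>z. I n z * w z)" by (rule Iw[OF Im[of n], of 1 n]) (use I01 in \<open>auto simp: I_def\<close>)
    have ifIw: "integrable \<mu> (\<lambda>z. f z * I n z * w z)"
    proof (rule Iw[OF fI(1)[of n], of C n])
      show "\<bar>f z * I n z\<bar> \<le> C * I n z" for z using fC[of z] I01[of n z] by auto
    qed
    have iQf: "integrable \<mu> (\<lambda>z. I n z * (w z * ((\<integral>y. f y \<partial>Q z) - f z)))"
      by (rule Bochner_Integration.integrable_bound[OF int'])
        (use mu[OF Im] int' I1[of n] in \<open>auto simp: abs_mult mult_left_le_one_le\<close>)
    \<comment> \<open>Inside the ball \<open>r\<close> is the weighted part of \<open>Q f\<close>
      coming from outside the ball; outside it is minus the part coming from inside. Correspondingly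
      \<open>bd\<close> is \<open>C\<close> times the outward flux density inside and
      \<open>C\<close> times the inward one outside.\<close>
    define r where "r z = I n z * w z * (\<integral>y. f y \<partial>Q z) - w z * (\<integral>y. f y * I n y \<partial>Q z)" for z
    have r_eq: "r z = f z * I n z * w z - w z * (\<integral>y. f y * I n y \<partial>Q z) + I n z * (w z * ((\<integral>y. f y \<partial>Q z) - f z))" for z
      by (simp add: r_def algebra_simps)
    have ir: "integrable \<mu> r" unfolding r_eq[abs_def] using 2(1) ifIw iQf by simp
    have "A n = (\<integral>z. f z * I n z * w z \<partial>\<mu>) - (\<integral>z. w z * (\<integral>y. f y * I n y \<partial>Q z) \<partial>\<mu>) + (\<integral>z. I n z * (w z * ((\<integral>y. f y \<partial>Q z) - f z)) \<partial>\<mu>)"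
      unfolding A_def 2(2)[symmetric] by (simp add: ac_simps)
    also have "\<dots> = (\<integral>z. r z \<partial>\<mu>)"
      unfolding r_eq[abs_def] using 2(1) ifIw iQf by simp
    finally have A_r: "A n = (\<integral>z. r z \<partial>\<mu>)" .
    define bd where "bd z = C * (2 * out n z - (I n z * w z - w z * (\<integral>y. I n y \<partial>Q z)))" for z
    have ibd: "integrable \<mu> bd" unfolding bd_def[abs_def] using out_int iIw 1(1) by simp
    have "\<bar>r z\<bar> \<le> bd z" for z
    proof (cases "I n z = 0")
      case True
      have "(\<integral>y. f y * I n y \<partial>Q z) \<le> (\<integral>y. C * I n y \<partial>Q z)"
        by (rule integral_mono[OF QfI]) (use QI f(3) I01 in \<open>auto intro!: mult_right_mono simp: I_def\<close>)
      then have "w z * (\<integral>y. f y * I n y \<partial>Q z) \<le> w z * (C * (\<integral>y. I n y \<partial>Q z))"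
        using w0[of z] by (simp add: mult_left_mono)
      moreover have "0 \<le> w z * (\<integral>y. f y * I n y \<partial>Q z)"
        using w0[of z] f(2) by (intro mult_nonneg_nonneg integral_nonneg_AE) (auto simp: I_def)
      ultimately show ?thesis using True by (simp add: r_def bd_def out_def ac_simps)
    next
      case False
      then have I: "I n z = 1" using I01 by blast
      interpret Q: prob_space "Q z" by (rule Q_prob)
      have eq: "(\<integral>y. f y \<partial>Q z) - (\<integral>y. f y * I n y \<partial>Q z) = (\<integral>y. f y * (1 - I n y) \<partial>Q z)"
        using Qf QfI by (simp add: right_diff_distrib)
      have ii: "integrable (Q z) (\<lambda>y. f y * (1 - I n y))" using Qf QfI by (simp add: right_diff_distrib)
      have "(\<integral>y. f y * (1 - I n y) \<partial>Q z) \<le> (\<integral>y. C * (1 - I n y) \<partial>Q z)"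
      proof (rule integral_mono[OF ii])
        show "integrable (Q z) (\<lambda>y. C * (1 - I n y))" using QI by simp
        show "f y * (1 - I n y) \<le> C * (1 - I n y)" for y
          using f(3)[of y] I01[of n y] by auto
      qed
      also have "\<dots> = C * (1 - (\<integral>y. I n y \<partial>Q z))" using QI by (simp add: Q.prob_space)
      finally have "w z * (\<integral>y. f y * (1 - I n y) \<partial>Q z) \<le> w z * (C * (1 - (\<integral>y. I n y \<partial>Q z)))"
        using w0[of z] by (rule mult_left_mono)
      moreover have "0 \<le> w z * (\<integral>y. f y * (1 - I n y) \<partial>Q z)"
        using w0[of z] f(2) by (intro mult_nonneg_nonneg integral_nonneg_AE) (auto simp: I_def indicator_def)
      moreover have "r z = w z * (\<integral>y. f y * (1 - I n y) \<partial>Q z)"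
        unfolding eq[symmetric] by (simp add: r_def I right_diff_distrib)
      moreover have "bd z = w z * (C * (1 - (\<integral>y. I n y \<partial>Q z)))"
        by (simp add: bd_def out_def I algebra_simps)
      ultimately show ?thesis by simp
    qed
    then have "\<bar>A n\<bar> \<le> (\<integral>z. bd z \<partial>\<mu>)" unfolding A_r by (intro abs_integral_le_AE ir ibd) simp
    also have "\<dots> = C * (2 * (\<integral>z. out n z \<partial>\<mu>) - (\<integral>z. I n z * k z \<partial>\<mu>))"
      unfolding bd_def[abs_def] 1(2) using out_int iIw 1(1) by simp
    finally show ?thesis .
  qed
  have "(\<lambda>n. C * (2 * (\<integral>z. out n z \<partial>\<mu>) - (\<integral>z. I n z * k z \<partial>\<mu>))) \<longlonglongrightarrow> C * (2 * 0 - 0)"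
    by (intro tendsto_intros out_lim) (use dom[OF k(1)] k(2) in simp)
  then have "(\<lambda>n. C * (2 * (\<integral>z. out n z \<partial>\<mu>) - (\<integral>z. I n z * k z \<partial>\<mu>))) \<longlonglongrightarrow> 0" by simp
  then have "A \<longlonglongrightarrow> 0"
    by (rule Lim_null_comparison[rotated]) (use A_le in simp)
  then have "(\<integral>z. f z * k z \<partial>\<mu>) + (\<integral>z. w z * ((\<integral>y. f y \<partial>Q z) - f z) \<partial>\<mu>) = 0"
    by (rule LIMSEQ_unique[OF A_lim])
  then show ?thesis by (simp add: w_def)
qed

theorem theorem3p1:
  fixes X :: "'z::banach \<Rightarrow> 'z"
    and \<phi> :: "real \<Rightarrow> 'z \<Rightarrow> 'z"
    and lr lb lam :: "'z \<Rightarrow> real"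
    and Qr Qb Q Qs :: "'z \<Rightarrow> 'z measure"
    and P :: "'z \<Rightarrow> 'w measure"
    and S :: "nat \<Rightarrow> 'w \<Rightarrow> ennreal"
    and Y :: "nat \<Rightarrow> 'w \<Rightarrow> 'z"
    and \<mu>0 :: "'z measure"
    and \<Phi> adj :: "'z \<Rightarrow> real"
  assumes "assumption_W X \<phi> lr lb lam Qr Qb Q"
    and "pdmp_process \<phi> lam Q P S Y"
    and "prob_space \<mu>0" and "sets \<mu>0 = sets borel"
    and "reversed_kernel \<mu>0 Q Qs"
    and "lower_semicontinuous \<Phi>" and "bdd_below (range \<Phi>)"
    and "has_L2_adjoint \<mu>0 (LX_dom \<phi> \<mu>0) (LX \<phi> \<mu>0) (\<lambda>z. exp (- \<Phi> z)) adj"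
    and "AE z in \<mu>0. integrable (Qs z) (\<lambda>y. lam y * exp (\<Phi> z - \<Phi> y)) \<and>
           exp (\<Phi> z) * adj z + (\<integral>y. lam y * exp (\<Phi> z - \<Phi> y) \<partial>Qs z) - lam z = 0"
  shows "\<forall>f \<in> LX_dom \<phi> \<mu>0 \<inter> generator_dom (pdmp_semigroup \<phi> P S Y).
           (\<integral>z. generator (pdmp_semigroup \<phi> P S Y) f z \<partial>gibbs_measure \<mu>0 \<Phi>) = 0"
proof
  fix f assume "f \<in> LX_dom \<phi> \<mu>0 \<inter> generator_dom (pdmp_semigroup \<phi> P S Y)"
  then have fX: "f \<in> LX_dom \<phi> \<mu>0" and fD: "f \<in> generator_dom (pdmp_semigroup \<phi> P S Y)" by auto
  interpret pdmp_W X \<phi> lr lb lam Qr Qb Q P S Y by (intro pdmp_W.intro assms)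
  interpret \<mu>: prob_space \<mu>0 by fact
  define h where "h = generator T f"
  define e where "e z = exp (- \<Phi> z)" for z
  have gen: "has_generator T f h" unfolding h_def by (rule has_generator_generator[OF fD])
  then have fb: "f \<in> bcontfun" and hb: "h \<in> bcontfun" by (auto simp: has_generator_def C0_def)
  have bc: "g \<in> borel_measurable borel" "\<exists>C. \<forall>x. \<bar>g x\<bar> \<le> C" if "g \<in> bcontfun" for g :: "'z \<Rightarrow> real"
    using that by (auto simp: bcontfun_def bounded_iff intro: borel_measurable_continuous_onI)
  note fm = bc(1)[OF fb] and hm = bc(1)[OF hb]
  obtain C where C: "\<And>x. \<bar>f x\<bar> \<le> C" using bc(2)[OF fb] by blast
  obtain H where H: "\<And>x. \<bar>h x\<bar> \<le> H" using bc(2)[OF hb] by blast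
  have mu: "g \<in> borel_measurable \<mu>0 \<longleftrightarrow> g \<in> borel_measurable borel" for g :: "'z \<Rightarrow> real"
    by (simp add: measurable_cong_sets[OF assms(4) refl])
  have eL: "e \<in> L2 \<mu>0" and aL: "adj \<in> L2 \<mu>0"
    and adj: "\<And>g. g \<in> LX_dom \<phi> \<mu>0 \<Longrightarrow> (\<integral>z. LX \<phi> \<mu>0 g z * e z \<partial>\<mu>0) = (\<integral>z. g z * adj z \<partial>\<mu>0)"
    using assms(8) by (auto simp: has_L2_adjoint_def e_def[abs_def])
  have em: "e \<in> borel_measurable borel" using eL by (simp add: L2_iff mu)
  obtain m where m: "\<And>z. m \<le> \<Phi> z" using assms(7) by (auto simp: bdd_below_def)
  have e: "0 \<le> e z" "e z \<le> exp (- m)" for z using m[of z] by (auto simp: e_def)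
  have oneL: "(\<lambda>_. 1) \<in> L2 \<mu>0" by (simp add: L2_iff)
  have ai: "integrable \<mu>0 adj" using L2_mult_integrable[OF oneL aL] by simp
  have one: "(\<lambda>_. 1) \<in> LX_dom \<phi> \<mu>0"
  proof -
    have "has_flow_deriv \<phi> \<mu>0 (\<lambda>_. 1) (\<lambda>_. 0)" by (simp add: has_flow_deriv_def L2_iff)
    then show ?thesis by (auto simp: LX_dom_def)
  qed
  \<comment> \<open>Even for a constant the chosen representative vanishes only almost
    everywhere.\<close>
  have "AE z in \<mu>0. LX \<phi> \<mu>0 (\<lambda>_. 1) z = 0"
    by (rule LX_pointwise[OF one]) simp
  then have "AE z in \<mu>0. LX \<phi> \<mu>0 (\<lambda>_. 1) z * e z = 0" by eventually_elim simp
  then have "(\<integral>z. LX \<phi> \<mu>0 (\<lambda>_. 1) z * e z \<partial>\<mu>0) = 0" by (rule integral_eq_zero_AE)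
  \<comment> \<open>This has two uses: it makes the inward flux vanish in the limit, and it makes
    the pairing with \<open>adj\<close> blind to adding constants.\<close>
  then have a0: "(\<integral>z. adj z \<partial>\<mu>0) = 0" using adj[OF one] by simp
  have bal: "AE z in \<mu>0. integrable (Qs z) (\<lambda>y. lam y * e y) \<and> adj z = lam z * e z - (\<integral>y. lam y * e y \<partial>Qs z)"
    using assms(9)
  proof eventually_elim
    case (elim z)
    have eq: "lam y * exp (\<Phi> z - \<Phi> y) = exp (\<Phi> z) * (lam y * e y)" for y
      by (simp add: e_def exp_diff exp_minus divide_inverse)
    have i: "integrable (Qs z) (\<lambda>y. lam y * e y)" using elim by (simp add: eq)
    have "exp (\<Phi> z) * (adj z + (\<integral>y. lam y * e y \<partial>Qs z)) = lam z"
      using elim by (simp add: eq distrib_left)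
    then have "e z * (exp (\<Phi> z) * (adj z + (\<integral>y. lam y * e y \<partial>Qs z))) = e z * lam z" by simp
    moreover have "e z * exp (\<Phi> z) = 1" by (simp add: e_def exp_add[symmetric])
    ultimately have "adj z + (\<integral>y. lam y * e y \<partial>Qs z) = e z * lam z"
      by (simp only: mult.assoc[symmetric] mult_1)
    then show ?case using i by (simp add: mult.commute)
  qed
  have LXL: "LX \<phi> \<mu>0 f \<in> L2 \<mu>0"
  proof -
    obtain g where "has_flow_deriv \<phi> \<mu>0 f g" using fX by (auto simp: LX_dom_def)
    then have "has_flow_deriv \<phi> \<mu>0 f (LX \<phi> \<mu>0 f)"
      unfolding LX_def by (rule someI[of "has_flow_deriv \<phi> \<mu>0 f"])
    then show ?thesis by (simp add: has_flow_deriv_def)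
  qed
  define v where "v z = lam z * e z * ((\<integral>y. f y \<partial>Q z) - f z)" for z
  have lm: "lam \<in> borel_measurable borel" by (rule borel_measurable_continuous_onI[OF lam_cont])
  have vm: "v \<in> borel_measurable borel"
    unfolding v_def[abs_def]
    by (intro borel_measurable_times borel_measurable_diff lm em fm Q_integral_measurable[OF fm C])
  have he: "integrable \<mu>0 (\<lambda>z. e z * h z)"
  proof (rule \<mu>.integrable_const_bound[of _ "exp (- m) * H"])
    have "\<bar>e z * h z\<bar> \<le> exp (- m) * H" for z
      unfolding abs_mult using e[of z] H[of z] by (intro mult_mono) auto
    then show "AE z in \<mu>0. norm (e z * h z) \<le> exp (- m) * H" by simp
  qed (use em hm in \<open>simp add: mu\<close>)
  have LXe: "integrable \<mu>0 (\<lambda>z. LX \<phi> \<mu>0 f z * e z)" by (rule L2_mult_integrable[OF LXL eL])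
  have veq: "AE z in \<mu>0. e z * h z - LX \<phi> \<mu>0 f z * e z = v z"
    using LX_generator[OF fD fX]
  proof eventually_elim
    case (elim z)
    show ?case unfolding elim v_def h_def by (simp add: algebra_simps)
  qed
  \<comment> \<open>Integrability of \<open>v\<close> is inherited from the two terms on the left of
    \<open>veq\<close>; the factor \<open>lam z * e z\<close> alone may fail to be
    integrable.\<close>
  have vi: "integrable \<mu>0 v"
    using integrable_cong_AE_imp[OF Bochner_Integration.integrable_diff[OF he LXe] _ veq] vm mu by blast
  \<comment> \<open>\<open>weak_balance\<close> is stated for nonnegative functions. The shift
    changes neither \<open>Q f - f\<close> nor, by \<open>a0\<close>, the pairing with
    \<open>adj\<close>.\<close>
  define f' where "f' z = f z + C" for z
  have f': "f' \<in> borel_measurable borel" "0 \<le> f' z" "f' z \<le> 2 * C" for z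
    using fm C[of z] by (auto simp: f'_def[abs_def])
  have Qf': "(\<integral>y. f' y \<partial>Q z) - f' z = (\<integral>y. f y \<partial>Q z) - f z" for z
    by (simp add: f'_def Q_integral_add_const[OF fm C])
  have vi': "integrable \<mu>0 (\<lambda>z. lam z * e z * ((\<integral>y. f' y \<partial>Q z) - f' z))"
    using vi by (simp add: Qf' v_def[abs_def])
  have "(\<integral>z. f' z * adj z \<partial>\<mu>0) = - (\<integral>z. lam z * e z * ((\<integral>y. f' y \<partial>Q z) - f' z) \<partial>\<mu>0)"
    by (rule weak_balance[OF assms(3,4,5) em e ai a0 bal f' vi'])
  moreover have "(\<integral>z. f' z * adj z \<partial>\<mu>0) = (\<integral>z. f z * adj z \<partial>\<mu>0)"
  proof -
    have fL: "f \<in> L2 \<mu>0" using fX by (auto simp: LX_dom_def has_flow_deriv_def)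
    show ?thesis using L2_mult_integrable[OF fL aL] ai a0 by (simp add: f'_def distrib_right)
  qed
  ultimately have fa: "(\<integral>z. f z * adj z \<partial>\<mu>0) = - (\<integral>z. v z \<partial>\<mu>0)"
    by (simp add: Qf' v_def)
  have "(\<integral>z. e z * h z \<partial>\<mu>0) - (\<integral>z. LX \<phi> \<mu>0 f z * e z \<partial>\<mu>0) = (\<integral>z. v z \<partial>\<mu>0)"
    unfolding Bochner_Integration.integral_diff[OF he LXe, symmetric]
    by (rule integral_cong_AE[OF _ _ veq]) (use he LXe vi in auto)
  \<comment> \<open>The integral of \<open>e z * h z\<close> is that of \<open>f z * adj z\<close>,
    by the adjoint relation, plus that of \<open>v\<close>; by \<open>fa\<close> these two are
    opposite.\<close>
  then have he0: "(\<integral>z. e z * h z \<partial>\<mu>0) = 0" using adj[OF fX] fa by simp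
  define Z where "Z = (\<integral>x. e x \<partial>\<mu>0)"
  have Z0: "0 \<le> Z" using e(1) by (simp add: Z_def)
  have gibbs: "gibbs_measure \<mu>0 \<Phi> = density \<mu>0 (\<lambda>z. ennreal (e z / Z))"
    by (simp add: gibbs_measure_def Z_def e_def)
  have "(\<integral>z. h z \<partial>gibbs_measure \<mu>0 \<Phi>) = (\<integral>z. (e z / Z) *\<^sub>R h z \<partial>\<mu>0)"
    unfolding gibbs using hm em e Z0 by (intro integral_density) (auto simp: mu)
  also have "\<dots> = (\<integral>z. (1 / Z) * (e z * h z) \<partial>\<mu>0)"
    by (intro Bochner_Integration.integral_cong) auto
  also have "\<dots> = 0" using he0 by simp
  finally show "(\<integral>z. generator T f z \<partial>gibbs_measure \<mu>0 \<Phi>) = 0" by (simp add: h_def)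
qed

end
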